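(* Let $\mathbb{K}$ be an algebraically closed field of characteristic $\neq 2$. Each PBW deformation of the Fomin--Kirillov algebra $\mathcal{E}_3$ in the category of $\mathbb{S}_3$-modules is of the form $\mathcal{D}_3(\gamma_1,\gamma_2)$ for some $\gamma_1,\gamma_2\in\mathbb{K}$ (that is, it is isomorphic to such an algebra, as a filtered algebra in the category of $\mathbb{S}_3$-modules).
   Context: For $\gamma_1,\gamma_2\in\mathbb{K}$, $\mathcal{D}_3(\gamma_1,\gamma_2)$ denotes the associative unital $\mathbb{K}$-algebra given by generators $a,b,c$ and relations $$a^2=b^2=c^2=\gamma_1,\qquad ca+bc+ab=\gamma_2,\qquad cb+ba+ac=\gamma_2.$$ It is filtered by degree in the generators (the $m$-th piece is spanned by words of length at most $m$ in $a,b,c$), and it is an $\mathbb{S}_3$-module algebra (the symmetric group $\mathbb{S}_3$ acts by algebra automorphisms) via $$(12)\cdot a=-b,\quad (12)\cdot b=-a,\quad (12)\cdot c=-c,\qquad (23)\cdot a=-a,\quad (23)\cdot b=-c,\quad (23)\cdot c=-b.$$ The Fomin--Kirillov algebra is $\mathcal{E}_3=\mathcal{D}_3(0,0)$, with this $\mathbb{S}_3$-action, $\mathbb{N}_0$-graded with $a,b,c$ in degree $1$. Let $\mathcal{C}$ be a monoidal category (here: the category of $\mathbb{K}\mathbb{S}_3$-modules) and let $A$ be an $\mathbb{N}_0$-graded algebra in $\mathcal{C}$. A PBW deformation of $A$ in $\mathcal{C}$ is an $\mathbb{N}_0$-filtered algebra $D$ in $\mathcal{C}$ such that $\mathrm{gr}\,D\cong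 A$ (as graded algebras in $\mathcal{C}$). *)

theory Defs
  imports
    "HOL-Algebra.Algebra"
    "HOL-Algebra.Algebraic_Closure_Type"
    "HOL-Library.Poly_Mapping"
begin

section \<open>Filtered and graded algebras in the category of modules over a group\<close>

text \<open>
  A \<open>K\<close>-algebra with an action of a group and a family of subspaces indexed by the natural
  numbers. For a filtered algebra \<open>piece A n\<close> is the \<open>n\<close>-th step of the filtration, for a graded
  algebra it is the homogeneous component of degree \<open>n\<close>.
\<close>

record ('g, 'k, 'a) module_alg = "('k, 'a) module" +
  act :: "'g \<Rightarrow> 'a \<Rightarrow> 'a"
  piece :: "nat \<Rightarrow> 'a set"

locale module_algebra = module K A + ring A + G: group G
  for G :: "('g, 'n) monoid_scheme" (structure) and K :: "('k, 'l) ring_scheme" (structure)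
    and A :: "('g, 'k, 'a, 'm) module_alg_scheme" (structure) +
  assumes smult_mult_left:
      "\<lbrakk>k \<in> carrier K; x \<in> carrier A; y \<in> carrier A\<rbrakk>
        \<Longrightarrow> (k \<odot>\<^bsub>A\<^esub> x) \<otimes>\<^bsub>A\<^esub> y = k \<odot>\<^bsub>A\<^esub> (x \<otimes>\<^bsub>A\<^esub> y)"
    and smult_mult_right:
      "\<lbrakk>k \<in> carrier K; x \<in> carrier A; y \<in> carrier A\<rbrakk>
        \<Longrightarrow> x \<otimes>\<^bsub>A\<^esub> (k \<odot>\<^bsub>A\<^esub> y) = k \<odot>\<^bsub>A\<^esub> (x \<otimes>\<^bsub>A\<^esub> y)"
    and act_closed: "\<lbrakk>g \<in> carrier G; x \<in> carrier A\<rbrakk> \<Longrightarrow> act A g x \<in> carrier A"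
    and act_one: "x \<in> carrier A \<Longrightarrow> act A \<one>\<^bsub>G\<^esub> x = x"
    and act_mult:
      "\<lbrakk>g \<in> carrier G; h \<in> carrier G; x \<in> carrier A\<rbrakk>
        \<Longrightarrow> act A (g \<otimes>\<^bsub>G\<^esub> h) x = act A g (act A h x)"
    and act_add:
      "\<lbrakk>g \<in> carrier G; x \<in> carrier A; y \<in> carrier A\<rbrakk>
        \<Longrightarrow> act A g (x \<oplus>\<^bsub>A\<^esub> y) = act A g x \<oplus>\<^bsub>A\<^esub> act A g y"
    and act_smult:
      "\<lbrakk>g \<in> carrier G; k \<in> carrier K; x \<in> carrier A\<rbrakk>
        \<Longrightarrow> act A g (k \<odot>\<^bsub>A\<^esub> x) = k \<odot>\<^bsub>A\<^esub> act A g x"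
    and act_times:
      "\<lbrakk>g \<in> carrier G; x \<in> carrier A; y \<in> carrier A\<rbrakk>
        \<Longrightarrow> act A g (x \<otimes>\<^bsub>A\<^esub> y) = act A g x \<otimes>\<^bsub>A\<^esub> act A g y"
    and act_unit: "g \<in> carrier G \<Longrightarrow> act A g \<one>\<^bsub>A\<^esub> = \<one>\<^bsub>A\<^esub>"

locale filtered_module_algebra = module_algebra +
  assumes piece_submodule: "submodule (piece A n) K A"
    and piece_act: "\<lbrakk>g \<in> carrier G; x \<in> piece A n\<rbrakk> \<Longrightarrow> act A g x \<in> piece A n"
    and piece_mono: "m \<le> n \<Longrightarrow> piece A m \<subseteq> piece A n"
    and piece_one: "\<one>\<^bsub>A\<^esub> \<in> piece A 0"
    and piece_mult: "\<lbrakk>x \<in> piece A m; y \<in> piece A n\<rbrakk> \<Longrightarrow> x \<otimes>\<^bsub>A\<^esub> y \<in> piece A (m + n)"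
    and piece_exhaustive: "(\<Union>n. piece A n) = carrier A"

text \<open>
  Isomorphisms of algebras with action that match the families of subspaces: isomorphisms of
  filtered algebras if both families are filtrations, of graded algebras if both are gradings.
\<close>

definition module_alg_iso ::
  "('g, 'm) monoid_scheme \<Rightarrow> ('k, 'n) ring_scheme \<Rightarrow> ('g, 'k, 'a) module_alg
    \<Rightarrow> ('g, 'k, 'b) module_alg \<Rightarrow> ('a \<Rightarrow> 'b) set"
  where "module_alg_iso G K A B = {\<phi> \<in> ring_iso A B.
    (\<forall>k\<in>carrier K. \<forall>x\<in>carrier A. \<phi> (k \<odot>\<^bsub>A\<^esub> x) = k \<odot>\<^bsub>B\<^esub> \<phi> x) \<and>
    (\<forall>g\<in>carrier G. \<forall>x\<in>carrier A. \<phi> (act A g x) = act B g (\<phi> x)) \<and>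
    (\<forall>n. \<phi> ` piece A n = piece B n)}"

text \<open>
  The map between cosets induced by \<open>f\<close>, in the style of \<^const>\<open>rcoset_mult\<close>. If \<open>f\<close> sends
  congruent elements to elements congruent modulo \<open>I\<close>, this maps the coset of \<open>x\<close> to that of \<open>f x\<close>.
\<close>

definition coset_map :: "('a, 'm) ring_scheme \<Rightarrow> 'a set \<Rightarrow> ('a \<Rightarrow> 'a) \<Rightarrow> 'a set \<Rightarrow> 'a set"
  where "coset_map R I f S = (\<Union>x\<in>S. I +>\<^bsub>R\<^esub> f x)"

definition quotient_alg :: "('g, 'k, 'a) module_alg \<Rightarrow> 'a set \<Rightarrow> ('g, 'k, 'a set) module_alg"
  where "quotient_alg A I =
    \<lparr>carrier = carrier (A Quot I), monoid.mult = monoid.mult (A Quot I), one = one (A Quot I),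
     ring.zero = ring.zero (A Quot I), ring.add = ring.add (A Quot I),
     module.smult = (\<lambda>k. coset_map A I (\<lambda>x. k \<odot>\<^bsub>A\<^esub> x)),
     act = (\<lambda>g. coset_map A I (act A g)),
     piece = (\<lambda>n. (\<lambda>x. I +>\<^bsub>A\<^esub> x) ` piece A n)\<rparr>"


section \<open>The associated graded algebra and PBW deformations\<close>

text \<open>The step of the filtration preceding the \<open>n\<close>-th one; it is zero for \<open>n = 0\<close>.\<close>

definition lower :: "('g, 'k, 'a) module_alg \<Rightarrow> nat \<Rightarrow> 'a set"
  where "lower D n = (case n of 0 \<Rightarrow> {\<zero>\<^bsub>D\<^esub>} | Suc m \<Rightarrow> piece D m)"

definition gr_component :: "('g, 'k, 'a) module_alg \<Rightarrow> nat \<Rightarrow> 'a set set"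
  where "gr_component D n = (\<lambda>x. lower D n +>\<^bsub>D\<^esub> x) ` piece D n"

text \<open>
  Elements of \<open>gr D\<close> are the finitely supported families of cosets \<open>f n \<in> gr_component D n\<close>;
  the zero of \<open>gr_component D n\<close> is \<open>lower D n\<close>. The degree \<open>n\<close> part of a product \<open>f g\<close> is the
  coset of the sum of all \<open>x\<^sub>i y\<^sub>n\<^sub>-\<^sub>i\<close>, where \<open>x\<^sub>i\<close> and \<open>y\<^sub>j\<close> represent \<open>f i\<close> and \<open>g j\<close>.
\<close>

definition gr :: "('g, 'k, 'a) module_alg \<Rightarrow> ('g, 'k, nat \<Rightarrow> 'a set) module_alg"
  where "gr D =
    (let C = {f. (\<forall>n. f n \<in> gr_component D n) \<and> finite {n. f n \<noteq> lower D n}} in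
    \<lparr>carrier = C,
     monoid.mult = (\<lambda>f g n. \<Union>{lower D n +>\<^bsub>D\<^esub> (\<Oplus>\<^bsub>D\<^esub>i\<in>{..n}. x i \<otimes>\<^bsub>D\<^esub> y (n - i)) | x y.
       (\<forall>i. x i \<in> f i) \<and> (\<forall>j. y j \<in> g j)}),
     one = (lower D)(0 := lower D 0 +>\<^bsub>D\<^esub> \<one>\<^bsub>D\<^esub>),
     ring.zero = lower D,
     ring.add = (\<lambda>f g n. f n <+>\<^bsub>D\<^esub> g n),
     module.smult = (\<lambda>k f n. coset_map D (lower D n) (\<lambda>x. k \<odot>\<^bsub>D\<^esub> x) (f n)),
     act = (\<lambda>g f n. coset_map D (lower D n) (act D g) (f n)),
     piece = (\<lambda>n. {f \<in> C. \<forall>m. m \<noteq> n \<longrightarrow> f m = lower D m})\<rparr>)"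

definition PBW_deformation ::
  "('g, 'm) monoid_scheme \<Rightarrow> ('k, 'n) ring_scheme \<Rightarrow> ('g, 'k, 'a) module_alg
    \<Rightarrow> ('g, 'k, 'd) module_alg \<Rightarrow> bool"
  where "PBW_deformation G K A D \<longleftrightarrow>
    filtered_module_algebra G K D \<and> module_alg_iso G K (gr D) A \<noteq> {}"


section \<open>The free algebra on three generators\<close>

datatype gen = Gen_a | Gen_b | Gen_c

datatype word = Word (letters: "gen list")

instantiation word :: monoid_add
begin

definition zero_word :: word where "0 = Word []"

definition plus_word :: "word \<Rightarrow> word \<Rightarrow> word" where "v + w = Word (letters v @ letters w)"

instance by standard (auto simp: zero_word_def plus_word_def)

end

text \<open>Finitely supported functions on words, with the convolution product.\<close>

type_synonym 'k free_alg = "word \<Rightarrow>\<^sub>0 'k"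

definition free_const :: "'k::field \<Rightarrow> 'k free_alg"
  where "free_const k = Poly_Mapping.single 0 k"

definition free_var :: "gen \<Rightarrow> 'k::field free_alg"
  where "free_var x = Poly_Mapping.single (Word [x]) 1"

text \<open>The endomorphism of the free algebra that sends each generator \<open>x\<close> to \<open>h x\<close>.\<close>

definition free_hom :: "(gen \<Rightarrow> 'k::field free_alg) \<Rightarrow> 'k free_alg \<Rightarrow> 'k free_alg"
  where "free_hom h p =
    (\<Sum>w\<in>Poly_Mapping.keys p. free_const (Poly_Mapping.lookup p w) * prod_list (map h (letters w)))"

text \<open>
  With \<open>a, b, c\<close> numbered \<open>1, 2, 3\<close>, the action of \<open>\<sigma>\<close> sends the \<open>i\<close>-th generator to \<open>sign \<sigma>\<close> times
  the \<open>\<sigma>(i)\<close>-th generator. The lemmas \<open>S3_act_12\<close> and \<open>S3_act_23\<close> below give the values on the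
  transpositions \<open>(12)\<close> and \<open>(23)\<close>.
\<close>

fun gen_index :: "gen \<Rightarrow> nat"
  where "gen_index Gen_a = 1" | "gen_index Gen_b = 2" | "gen_index Gen_c = 3"

definition perm_gen :: "(nat \<Rightarrow> nat) \<Rightarrow> gen \<Rightarrow> gen"
  where "perm_gen \<sigma> x = (THE y. gen_index y = \<sigma> (gen_index x))"

definition S3_act :: "(nat \<Rightarrow> nat) \<Rightarrow> 'k::field free_alg \<Rightarrow> 'k free_alg"
  where "S3_act \<sigma> = free_hom (\<lambda>x. of_int (sign \<sigma>) * free_var (perm_gen \<sigma> x))"

definition free_filtered :: "(nat \<Rightarrow> nat, 'k::field, 'k free_alg) module_alg"
  where "free_filtered =
    \<lparr>carrier = UNIV, monoid.mult = (*), one = 1, ring.zero = 0, ring.add = (+),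
     module.smult = (\<lambda>k p. free_const k * p), act = S3_act,
     piece = (\<lambda>n. {p. \<forall>w\<in>Poly_Mapping.keys p. length (letters w) \<le> n})\<rparr>"

definition free_graded :: "(nat \<Rightarrow> nat, 'k::field, 'k free_alg) module_alg"
  where "free_graded = free_filtered
    \<lparr>piece := (\<lambda>n. {p. \<forall>w\<in>Poly_Mapping.keys p. length (letters w) = n})\<rparr>"


section \<open>The algebras \<open>\<D>\<^sub>3(\<gamma>\<^sub>1, \<gamma>\<^sub>2)\<close> and the Fomin--Kirillov algebra\<close>

definition D3_relators :: "'k::field \<Rightarrow> 'k \<Rightarrow> 'k free_alg set"
  where "D3_relators \<gamma>1 \<gamma>2 =
    (let a = free_var Gen_a; b = free_var Gen_b; c = free_var Gen_c in
      {a * a - free_const \<gamma>1, b * b - free_const \<gamma>1, c * c - free_const \<gamma>1,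
       c * a + b * c + a * b - free_const \<gamma>2, c * b + b * a + a * c - free_const \<gamma>2})"

definition D3 :: "'k::field \<Rightarrow> 'k \<Rightarrow> (nat \<Rightarrow> nat, 'k, 'k free_alg set) module_alg"
  where "D3 \<gamma>1 \<gamma>2 = quotient_alg free_filtered (Idl\<^bsub>free_filtered\<^esub> D3_relators \<gamma>1 \<gamma>2)"

definition E3 :: "(nat \<Rightarrow> nat, 'k::field, 'k free_alg set) module_alg"
  where "E3 = quotient_alg free_graded (Idl\<^bsub>free_graded\<^esub> D3_relators 0 0)"

section \<open>The action on the generators and on \<open>\<D>\<^sub>3(\<gamma>\<^sub>1, \<gamma>\<^sub>2)\<close>\<close>

lemma gen_index_eq_iff [simp]: "gen_index x = gen_index y \<longleftrightarrow> x = y"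
  by (cases x; cases y) auto

lemma gen_index_range: "gen_index x \<in> {1..3}"
  by (cases x) auto

lemma gen_index_surj: "i \<in> {1..3} \<Longrightarrow> \<exists>x. gen_index x = i"
proof -
  assume "i \<in> {1..3::nat}"
  then have "i = 1 \<or> i = 2 \<or> i = 3" by auto
  then show ?thesis
    by (metis gen_index.simps)
qed

lemma perm_gen_eqI: "gen_index y = \<sigma> (gen_index x) \<Longrightarrow> perm_gen \<sigma> x = y"
  unfolding perm_gen_def by (rule the_equality) (simp, simp flip: gen_index_eq_iff)

lemma gen_index_perm_gen:
  assumes "\<sigma> permutes {1..3}"
  shows "gen_index (perm_gen \<sigma> x) = \<sigma> (gen_index x)"
proof -
  have "\<sigma> (gen_index x) \<in> {1..3}"
    using assms gen_index_range by (simp only: permutes_in_image)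
  then show ?thesis
    using gen_index_surj perm_gen_eqI by metis
qed

lemma free_const_0 [simp]: "free_const 0 = 0" and free_const_1 [simp]: "free_const 1 = 1"
  and free_const_add: "free_const (k + l) = free_const k + free_const l"
  and free_const_mult: "free_const (k * l) = free_const k * free_const l"
  and free_const_uminus: "free_const (- k) = - free_const k"
  by (simp_all add: free_const_def single_add mult_single single_uminus)

lemma free_induct [case_names single sum]:
  assumes single: "\<And>w k. P (Poly_Mapping.single w k)" and sum: "\<And>p q. P p \<Longrightarrow> P q \<Longrightarrow> P (p + q)"
  shows "P (p :: 'k::field free_alg)"
proof (induction p rule: update_induct)
  case const
  then show ?case using single[of 0 0] by simp
next
  case (update p w k)
  then have "Poly_Mapping.update w k p = p + Poly_Mapping.single w k"
    by (intro poly_mapping_eqI) (auto simp: lookup_update lookup_add lookup_single in_keys_iff when_def)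
  then show ?case using update single sum by simp
qed

lemma free_const_commute: "free_const k * p = p * free_const k"
proof (induction p rule: free_induct)
  case (single w l)
  then show ?case by (simp add: free_const_def mult_single mult.commute)
next
  case (sum p q)
  then show ?case by (simp add: algebra_simps)
qed

lemma single_eq: "Poly_Mapping.single w k = free_const k * prod_list (map free_var (letters w))"
proof (cases w)
  case (Word xs)
  have "prod_list (map free_var xs) = Poly_Mapping.single (Word xs) (1 :: 'a)"
  proof (induction xs)
    case Nil
    then show ?case by (simp add: zero_word_def[symmetric])
  next
    case (Cons x xs)
    then show ?case by (simp add: free_var_def mult_single plus_word_def)
  qed
  with Word show ?thesis by (simp add: free_const_def mult_single)
qed

lemma free_hom_alt:
  assumes "finite W" "Poly_Mapping.keys p \<subseteq> W"
  shows "free_hom h p =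
    (\<Sum>w\<in>W. free_const (Poly_Mapping.lookup p w) * prod_list (map h (letters w)))"
  unfolding free_hom_def
  by (rule sum.mono_neutral_left) (use assms in \<open>auto simp: in_keys_iff\<close>)

lemma free_hom_0 [simp]: "free_hom h 0 = 0"
  by (simp add: free_hom_def)

lemma free_hom_add: "free_hom h (p + q) = free_hom h p + free_hom h q"
proof -
  let ?W = "Poly_Mapping.keys p \<union> Poly_Mapping.keys q"
  have *: "finite ?W" by simp
  show ?thesis
    using free_hom_alt[OF *, of p h] free_hom_alt[OF *, of q h]
      free_hom_alt[OF *, of "p + q" h] Poly_Mapping.keys_add[of p q]
    by (simp add: lookup_add free_const_add distrib_right sum.distrib)
qed

lemma free_hom_single:
  "free_hom h (Poly_Mapping.single w k) = free_const k * prod_list (map h (letters w))"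
  using free_hom_alt[of "{w}" "Poly_Mapping.single w k" h] by (auto simp: lookup_single)

lemma free_hom_const [simp]: "free_hom h (free_const k) = free_const k"
  unfolding free_const_def by (subst free_hom_single) (simp add: zero_word_def free_const_def)

lemma free_hom_1 [simp]: "free_hom h 1 = 1"
  using free_hom_const[of h 1] by simp

lemma free_hom_var [simp]: "free_hom h (free_var x) = h x"
  by (simp add: free_var_def free_hom_single)

lemma free_hom_mult: "free_hom h (p * q) = free_hom h p * free_hom h q"
proof (induction p rule: free_induct)
  case (single v k)
  show ?case
  proof (induction q rule: free_induct)
    case (single w l)
    have "free_hom h (Poly_Mapping.single v k * Poly_Mapping.single w l) =
      free_const k * free_const l * (prod_list (map h (letters v)) * prod_list (map h (letters w)))"
      by (simp add: mult_single free_hom_single free_const_mult plus_word_def)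
    also have "\<dots> = free_const k * (free_const l * prod_list (map h (letters v))) * prod_list (map h (letters w))"
      by (simp add: mult.assoc)
    also have "free_const l * prod_list (map h (letters v)) = prod_list (map h (letters v)) * free_const l"
      by (rule free_const_commute)
    finally show ?case
      by (simp add: free_hom_single mult.assoc)
  next
    case (sum p q)
    then show ?case by (simp add: distrib_left free_hom_add)
  qed
next
  case (sum p q)
  then show ?case by (simp add: distrib_right free_hom_add)
qed

lemma free_hom_uminus: "free_hom h (- p) = - free_hom h p"
  using free_hom_add[of h p "- p"] by (simp add: eq_neg_iff_add_eq_0 add.commute)

lemma free_hom_diff: "free_hom h (p - q) = free_hom h p - free_hom h q"
  using free_hom_add[of h p "- q"] by (simp add: free_hom_uminus)

lemma free_hom_eqI:
  assumes add: "\<And>p q. f (p + q) = f p + f q" and mult: "\<And>p q. f (p * q) = f p * f q"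
    and free_const: "\<And>k. f (free_const k) = free_const k" and free_var: "\<And>x. f (free_var x) = h x"
  shows "f = free_hom h"
proof
  fix p
  have prod: "f (prod_list (map free_var xs)) = prod_list (map h xs)" for xs
    using free_const[of 1] by (induction xs) (simp_all add: mult free_var)
  show "f p = free_hom h p"
  proof (induction p rule: free_induct)
    case (single w k)
    show ?case unfolding free_hom_single by (simp add: single_eq mult free_const prod)
  next
    case (sum p q)
    then show ?case by (simp add: add free_hom_add)
  qed
qed

lemma free_hom_of_int [simp]: "free_hom h (of_int n) = of_int n"
proof -
  have nat: "free_hom h (of_nat m) = of_nat m" for m
    by (induction m) (simp_all add: free_hom_add)
  show ?thesis
    by (cases n) (simp_all add: nat free_hom_uminus free_hom_diff)
qed

text \<open>The action of \<open>(12)\<close> and \<open>(23)\<close>, which generate the group, on the generators.\<close>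

lemma S3_act_12:
  fixes t :: "nat \<Rightarrow> nat"
  defines "t \<equiv> Transposition.transpose 1 2"
  shows "S3_act t (free_var Gen_a) = - free_var Gen_b"
    and "S3_act t (free_var Gen_b) = - free_var Gen_a"
    and "S3_act t (free_var Gen_c) = - free_var Gen_c"
proof -
  have "perm_gen t Gen_a = Gen_b" "perm_gen t Gen_b = Gen_a" "perm_gen t Gen_c = Gen_c"
    by (rule perm_gen_eqI; simp add: t_def transpose_def)+
  moreover have "sign t = -1" by (simp add: t_def sign_swap_id)
  ultimately show "S3_act t (free_var Gen_a) = - free_var Gen_b" "S3_act t (free_var Gen_b) = - free_var Gen_a"
    "S3_act t (free_var Gen_c) = - free_var Gen_c"
    by (simp_all add: S3_act_def)
qed

lemma S3_act_23:
  fixes t :: "nat \<Rightarrow> nat"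
  defines "t \<equiv> Transposition.transpose 2 3"
  shows "S3_act t (free_var Gen_a) = - free_var Gen_a"
    and "S3_act t (free_var Gen_b) = - free_var Gen_c"
    and "S3_act t (free_var Gen_c) = - free_var Gen_b"
proof -
  have "perm_gen t Gen_a = Gen_a" "perm_gen t Gen_b = Gen_c" "perm_gen t Gen_c = Gen_b"
    by (rule perm_gen_eqI; simp add: t_def transpose_def)+
  moreover have "sign t = -1" by (simp add: t_def sign_swap_id)
  ultimately show "S3_act t (free_var Gen_a) = - free_var Gen_a" "S3_act t (free_var Gen_b) = - free_var Gen_c"
    "S3_act t (free_var Gen_c) = - free_var Gen_b"
    by (simp_all add: S3_act_def)
qed

lemma S3_act_id: "S3_act id p = p"
proof -
  have "perm_gen id x = x" for x by (rule perm_gen_eqI) simp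
  then have "(\<lambda>p. p) = free_hom (\<lambda>x. of_int (sign id) * free_var (perm_gen id x))"
    by (intro free_hom_eqI) (auto simp: sign_id)
  then show ?thesis unfolding S3_act_def by metis
qed

lemma S3_act_comp:
  assumes "\<sigma> permutes {1..3}" "\<tau> permutes {1..3}"
  shows "S3_act (\<sigma> \<circ> \<tau>) p = S3_act \<sigma> (S3_act \<tau> p)"
proof -
  have *: "perm_gen (\<sigma> \<circ> \<tau>) x = perm_gen \<sigma> (perm_gen \<tau> x)" for x
    by (rule perm_gen_eqI) (simp only: gen_index_perm_gen assms o_apply)
  have "permutation \<sigma>" "permutation \<tau>"
    using assms unfolding permutation_permutes by blast+
  then have sign: "sign (\<sigma> \<circ> \<tau>) = sign \<tau> * sign \<sigma>" by (simp add: sign_compose mult.commute)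
  have "(\<lambda>p. S3_act \<sigma> (S3_act \<tau> p)) =
    free_hom (\<lambda>x. of_int (sign (\<sigma> \<circ> \<tau>)) * free_var (perm_gen (\<sigma> \<circ> \<tau>) x))"
    by (rule free_hom_eqI)
      (simp_all add: S3_act_def free_hom_add free_hom_mult * sign mult.assoc)
  then show ?thesis unfolding S3_act_def[of "\<sigma> \<circ> \<tau>"] by metis
qed

lemma (in ideal) coset_map_coset:
  assumes "x \<in> carrier R" "\<And>y. y \<in> carrier R \<Longrightarrow> f y \<in> carrier R"
    and "\<And>y z. \<lbrakk>y \<in> carrier R; z \<in> carrier R\<rbrakk> \<Longrightarrow> f (y \<oplus> z) = f y \<oplus> f z"
    and "\<And>y. y \<in> I \<Longrightarrow> f y \<in> I"
  shows "coset_map R I f (I +> x) = I +> f x"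
proof -
  have "I +> f y = I +> f x" if y: "y \<in> I +> x" for y
  proof -
    obtain i where i: "i \<in> I" "y = i \<oplus> x" using y by (auto simp: a_r_coset_def')
    have "i \<in> carrier R" using i(1) a_subset by (rule set_rev_mp)
    then have "f y = f i \<oplus> f x" unfolding i(2) using assms(1) by (rule assms(3))
    then have "f y \<in> I +> f x" using assms(4)[OF i(1)] unfolding a_r_coset_def' by auto
    from a_repr_independence'[OF this assms(2)[OF assms(1)]] show ?thesis by (rule sym)
  qed
  moreover have "x \<in> I +> x" using assms(1) by (rule a_rcos_self)
  ultimately show ?thesis
    unfolding coset_map_def using SUP_eq_const[of "I +> x" "\<lambda>y. I +> f y"] by (metis empty_iff)
qed

lemma quotient_alg_simps:
  "carrier (quotient_alg A I) = carrier (A Quot I)"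
  "monoid.mult (quotient_alg A I) = monoid.mult (A Quot I)"
  "one (quotient_alg A I) = one (A Quot I)"
  "ring.zero (quotient_alg A I) = ring.zero (A Quot I)"
  "ring.add (quotient_alg A I) = ring.add (A Quot I)"
  "module.smult (quotient_alg A I) k = coset_map A I (\<lambda>x. k \<odot>\<^bsub>A\<^esub> x)"
  "act (quotient_alg A I) g = coset_map A I (act A g)"
  "piece (quotient_alg A I) n = (\<lambda>x. I +>\<^bsub>A\<^esub> x) ` piece A n"
  by (simp_all add: quotient_alg_def)

lemma ring_quotient_alg:
  assumes "ideal I A"
  shows "ring (quotient_alg A I)"
proof -
  interpret Q: ring "A Quot I" using assms by (rule ideal.quotient_is_ring)
  show ?thesis
    by (intro ringI abelian_groupI monoidI)
      (auto simp: quotient_alg_simps Q.a_ac Q.m_assoc Q.l_distr Q.r_distr intro: Q.l_neg)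
qed

lemma filtered_quotient_alg:
  fixes A :: "('g, 'k, 'a) module_alg"
  assumes "filtered_module_algebra G K A" and "ideal I A"
    and inv: "\<And>g x. \<lbrakk>g \<in> carrier G; x \<in> I\<rbrakk> \<Longrightarrow> act A g x \<in> I"
  shows "filtered_module_algebra G K (quotient_alg A I)"
proof -
  interpret A: filtered_module_algebra G K A by fact
  interpret I: ideal I A by fact
  let ?Q = "quotient_alg A I"
  interpret Q: ring ?Q using \<open>ideal I A\<close> by (rule ring_quotient_alg)
  have carr: "carrier ?Q = (\<lambda>x. I +>\<^bsub>A\<^esub> x) ` carrier A"
    by (auto simp: quotient_alg_simps FactRing_simps)
  have mult: "(I +>\<^bsub>A\<^esub> x) \<otimes>\<^bsub>?Q\<^esub> (I +>\<^bsub>A\<^esub> y) = I +>\<^bsub>A\<^esub> (x \<otimes>\<^bsub>A\<^esub> y)"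
    if "x \<in> carrier A" "y \<in> carrier A" for x y
    using that by (simp add: quotient_alg_simps FactRing_def I.rcoset_mult_add)
  have add: "(I +>\<^bsub>A\<^esub> x) \<oplus>\<^bsub>?Q\<^esub> (I +>\<^bsub>A\<^esub> y) = I +>\<^bsub>A\<^esub> (x \<oplus>\<^bsub>A\<^esub> y)"
    if "x \<in> carrier A" "y \<in> carrier A" for x y
    using that by (simp add: quotient_alg_simps FactRing_def I.a_rcos_sum)
  have one: "\<one>\<^bsub>?Q\<^esub> = I +>\<^bsub>A\<^esub> \<one>\<^bsub>A\<^esub>"
    by (simp add: quotient_alg_simps FactRing_def)
  have zero: "\<zero>\<^bsub>?Q\<^esub> = I +>\<^bsub>A\<^esub> \<zero>\<^bsub>A\<^esub>"
    using A.a_coset_add_zero[OF I.a_subset] by (simp add: quotient_alg_simps FactRing_def)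
  have smult_I: "k \<odot>\<^bsub>A\<^esub> x \<in> I" if "k \<in> carrier K" "x \<in> I" for k x
  proof -
    have "x \<in> carrier A" using that I.a_subset by auto
    then have "k \<odot>\<^bsub>A\<^esub> x = (k \<odot>\<^bsub>A\<^esub> \<one>\<^bsub>A\<^esub>) \<otimes>\<^bsub>A\<^esub> x"
      using that by (simp add: A.smult_mult_left)
    then show ?thesis using that I.I_l_closed by simp
  qed
  have smult: "k \<odot>\<^bsub>?Q\<^esub> (I +>\<^bsub>A\<^esub> x) = I +>\<^bsub>A\<^esub> (k \<odot>\<^bsub>A\<^esub> x)"
    if "k \<in> carrier K" "x \<in> carrier A" for k x
    using that unfolding quotient_alg_simps
    by (intro I.coset_map_coset) (auto simp: A.smult_r_distr smult_I)
  have act: "act ?Q g (I +>\<^bsub>A\<^esub> x) = I +>\<^bsub>A\<^esub> act A g x"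
    if "g \<in> carrier G" "x \<in> carrier A" for g x
    using that unfolding quotient_alg_simps
    by (intro I.coset_map_coset) (auto simp: A.act_closed A.act_add inv)
  have piece: "piece ?Q n = (\<lambda>x. I +>\<^bsub>A\<^esub> x) ` piece A n" for n
    by (simp add: quotient_alg_simps)
  have piece_sub: "x \<in> carrier A" if "x \<in> piece A n" for x n
    using that A.piece_exhaustive by blast
  interpret Q: module K ?Q
    by (rule moduleI)
      (auto simp: carr smult add A.smult_l_distr A.smult_r_distr A.smult_assoc1
        intro: module.axioms(1)[OF A.module_axioms] Q.abelian_group_axioms)
  have Qm: "module_algebra G K ?Q"
    by unfold_locales
      (auto simp: carr smult add mult act one A.smult_mult_left A.smult_mult_right A.act_closed
        A.act_one A.act_mult A.act_add A.act_smult A.act_times A.act_unit)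
  have sub: "submodule (piece ?Q n) K ?Q" for n
  proof (rule Q.submoduleI)
    note E = A.submoduleE[OF A.piece_submodule[of n]]
    show "piece ?Q n \<subseteq> carrier ?Q" using piece_sub by (auto simp: piece carr)
    show *: "\<zero>\<^bsub>?Q\<^esub> \<in> piece ?Q n"
      using subgroup.one_closed[OF submodule.axioms(1)[OF A.piece_submodule[of n]]]
      by (auto simp: piece zero)
    show sm: "k \<odot>\<^bsub>?Q\<^esub> x \<in> piece ?Q n" if "k \<in> carrier K" "x \<in> piece ?Q n" for k x
      using that E(4) piece_sub by (auto simp: piece smult)
    show "x \<oplus>\<^bsub>?Q\<^esub> y \<in> piece ?Q n" if "x \<in> piece ?Q n" "y \<in> piece ?Q n" for x y
      using that E(5) piece_sub by (auto simp: piece add)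
    show "\<ominus>\<^bsub>?Q\<^esub> x \<in> piece ?Q n" if x: "x \<in> piece ?Q n" for x
    proof -
      have "x \<in> carrier ?Q" using x piece_sub by (auto simp: piece carr)
      then have "\<ominus>\<^bsub>?Q\<^esub> x = (\<ominus>\<^bsub>K\<^esub> \<one>\<^bsub>K\<^esub>) \<odot>\<^bsub>?Q\<^esub> x"
        by (simp add: Q.smult_l_minus)
      then show ?thesis using x sm by simp
    qed
  qed
  show ?thesis
  proof (intro filtered_module_algebra.intro Qm filtered_module_algebra_axioms.intro sub)
    show "act ?Q g x \<in> piece ?Q n" if "g \<in> carrier G" "x \<in> piece ?Q n" for g x n
      using that piece_sub A.piece_act by (auto simp: piece act)
    show "piece ?Q m \<subseteq> piece ?Q n" if "m \<le> n" for m n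
      unfolding piece by (intro image_mono A.piece_mono that)
    show "\<one>\<^bsub>?Q\<^esub> \<in> piece ?Q 0"
      unfolding piece one by (intro imageI A.piece_one)
    show "x \<otimes>\<^bsub>?Q\<^esub> y \<in> piece ?Q (m + n)" if "x \<in> piece ?Q m" "y \<in> piece ?Q n" for x y m n
      using that piece_sub A.piece_mult by (auto simp: piece mult)
    show "(\<Union>n. piece ?Q n) = carrier ?Q"
      unfolding piece carr A.piece_exhaustive[symmetric] by blast
  qed
qed

definition free_upto :: "nat \<Rightarrow> 'k::field free_alg set"
  where "free_upto n = {p. \<forall>w\<in>Poly_Mapping.keys p. length (letters w) \<le> n}"

lemma free_upto_0: "0 \<in> free_upto n"
  by (simp add: free_upto_def)

lemma free_upto_add: "\<lbrakk>p \<in> free_upto n; q \<in> free_upto n\<rbrakk> \<Longrightarrow> p + q \<in> free_upto n"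
  using Poly_Mapping.keys_add[of p q] by (auto simp: free_upto_def)

lemma free_upto_mult: "\<lbrakk>p \<in> free_upto m; q \<in> free_upto n\<rbrakk> \<Longrightarrow> p * q \<in> free_upto (m + n)"
  using Poly_Mapping.keys_mult[of p q] by (fastforce simp: free_upto_def plus_word_def)

lemma free_upto_const: "free_const k \<in> free_upto 0"
  by (auto simp: free_upto_def free_const_def zero_word_def)

lemma free_upto_1: "1 \<in> free_upto 0"
  using free_upto_const[of 1] by simp

lemma free_upto_const_mult: "p \<in> free_upto n \<Longrightarrow> free_const k * p \<in> free_upto n"
  using free_upto_mult[OF free_upto_const] by fastforce

lemma free_upto_mono: "m \<le> n \<Longrightarrow> free_upto m \<subseteq> free_upto n"
  by (auto simp: free_upto_def)

lemma free_upto_exhaustive: "(\<Union>n. free_upto n) = UNIV"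
proof -
  have "p \<in> free_upto (Max ((\<lambda>w. length (letters w)) ` Poly_Mapping.keys p))" for p :: "'a free_alg"
    by (auto simp: free_upto_def)
  then show ?thesis by blast
qed

lemma free_upto_S3_act:
  assumes "p \<in> free_upto n"
  shows "S3_act \<sigma> p \<in> free_upto n"
proof -
  let ?h = "\<lambda>x. of_int (sign \<sigma>) * free_var (perm_gen \<sigma> x) :: 'a free_alg"
  have "sign \<sigma> = 1 \<or> sign \<sigma> = -1" by (simp add: sign_def)
  then have h: "?h x \<in> free_upto 1" for x
    by (auto simp: free_upto_def free_var_def)
  have prod: "prod_list (map ?h xs) \<in> free_upto (length xs)" for xs
    by (induction xs) (use free_upto_1 free_upto_mult[OF h] in auto)
  have sum: "sum f S \<in> free_upto n" if "\<And>w. w \<in> S \<Longrightarrow> f w \<in> free_upto n"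
    for f :: "word \<Rightarrow> 'a free_alg" and S
    using that by (induction S rule: infinite_finite_induct) (auto simp: free_upto_0 free_upto_add)
  show ?thesis
    unfolding S3_act_def free_hom_def
  proof (intro sum free_upto_const_mult)
    fix w assume "w \<in> Poly_Mapping.keys p"
    with assms have "length (letters w) \<le> n" by (simp add: free_upto_def)
    with prod free_upto_mono show "prod_list (map ?h (letters w)) \<in> free_upto n" by blast
  qed
qed

lemma filtered_free:
  "filtered_module_algebra (sym_group 3) (ring_of_type_algebra :: 'k::field ring)
    (free_filtered :: (nat \<Rightarrow> nat, 'k, 'k free_alg) module_alg)"
  (is "filtered_module_algebra ?G ?K ?A")
proof -
  have ag: "abelian_group ?A"
    by (rule abelian_groupI) (auto simp: free_filtered_def algebra_simps intro: exI[of _ "- _"])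
  interpret A: ring ?A
    by (rule ringI[OF ag monoidI]) (auto simp: free_filtered_def algebra_simps)
  interpret G: group ?G by (rule sym_group_is_group)
  interpret A: module ?K ?A
    by (rule moduleI)
      (auto simp: free_filtered_def ring_of_type_algebra_def free_const_add free_const_mult
        algebra_simps intro: cring_from_type_algebra[unfolded ring_of_type_algebra_def]
        ag[unfolded free_filtered_def])
  have m: "module_algebra ?G ?K ?A"
  proof unfold_locales
    fix k :: 'k and x y :: "'k free_alg"
    have "x * (free_const k * y) = free_const k * (x * y)"
      using free_const_commute[of k x] by (simp flip: mult.assoc)
    then show "x \<otimes>\<^bsub>?A\<^esub> (k \<odot>\<^bsub>?A\<^esub> y) = k \<odot>\<^bsub>?A\<^esub> (x \<otimes>\<^bsub>?A\<^esub> y)"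
      by (simp add: free_filtered_def)
  next
    fix x :: "'k free_alg"
    show "act ?A \<one>\<^bsub>?G\<^esub> x = x"
      by (simp add: free_filtered_def sym_group_one S3_act_id)
  next
    fix g h and x :: "'k free_alg"
    assume "g \<in> carrier ?G" "h \<in> carrier ?G"
    then show "act ?A (g \<otimes>\<^bsub>?G\<^esub> h) x = act ?A g (act ?A h x)"
      by (simp add: free_filtered_def sym_group_mult sym_group_carrier S3_act_comp)
  qed (auto simp: free_filtered_def S3_act_def free_hom_add free_hom_mult mult.assoc)
  have fields: "act ?A = S3_act" "monoid.mult ?A = (*)" "one ?A = 1" "carrier ?A = UNIV"
    by (simp_all add: free_filtered_def)
  have piece: "piece ?A n = free_upto n" for n
    by (simp add: free_filtered_def free_upto_def)
  have "submodule (free_upto n) ?K ?A" for n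
  proof (rule A.submoduleI)
    have minus: "\<ominus>\<^bsub>?A\<^esub> x = - x" for x :: "'k free_alg"
      by (rule abelian_group.minus_equality[OF ag]) (simp_all add: free_filtered_def)
    show "\<ominus>\<^bsub>?A\<^esub> x \<in> free_upto n" if "x \<in> free_upto n" for x :: "'k free_alg"
      using that by (auto simp: minus free_upto_def)
  qed (auto simp: free_filtered_def free_upto_add free_upto_0 free_upto_const_mult)
  then show ?thesis
    by (intro filtered_module_algebra.intro m filtered_module_algebra_axioms.intro)
      (simp_all add: piece fields free_upto_S3_act free_upto_mult free_upto_mono
        free_upto_exhaustive free_upto_1)
qed

lemma D3_relators_square: "free_var x * free_var x - free_const \<gamma>1 \<in> D3_relators \<gamma>1 \<gamma>2"
  by (cases x) (simp_all add: D3_relators_def Let_def)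

lemma D3_relators_triangle:
  fixes \<gamma>1 \<gamma>2 :: "'a::field"
  assumes "x \<noteq> y" "x \<noteq> z" "y \<noteq> z"
  shows "free_var z * free_var x + free_var y * free_var z + free_var x * free_var y
    - free_const \<gamma>2 \<in> D3_relators \<gamma>1 \<gamma>2" (is "?r x y z \<in> _")
proof -
  have rotate: "?r x y z = ?r y z x" for x y z
    by (simp only: add.commute add.left_commute)
  have "?r Gen_a Gen_b Gen_c \<in> D3_relators \<gamma>1 \<gamma>2" "?r Gen_b Gen_a Gen_c \<in> D3_relators \<gamma>1 \<gamma>2"
    unfolding D3_relators_def Let_def by (simp_all only: add.commute add.left_commute insert_iff simp_thms)
  with assms show ?thesis
    using rotate[of Gen_a Gen_b Gen_c] rotate[of Gen_b Gen_c Gen_a]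
      rotate[of Gen_b Gen_a Gen_c] rotate[of Gen_a Gen_c Gen_b]
    by (cases x; cases y; cases z) (simp_all only: simp_thms gen.distinct)
qed

lemma D3_relators_act:
  fixes r :: "'a::field free_alg"
  assumes "\<sigma> permutes {1..3}" "r \<in> D3_relators \<gamma>1 \<gamma>2"
  shows "S3_act \<sigma> r \<in> D3_relators \<gamma>1 \<gamma>2"
proof -
  let ?p = "perm_gen \<sigma>"
  have "sign \<sigma> = 1 \<or> sign \<sigma> = -1" by (simp add: sign_def)
  then have prod: "S3_act \<sigma> (free_var x * free_var y) = (free_var (?p x) * free_var (?p y) :: 'a free_alg)"
    for x y
    by (auto simp: S3_act_def free_hom_mult)
  have hom: "S3_act \<sigma> (q + q') = S3_act \<sigma> q + S3_act \<sigma> q'"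
    "S3_act \<sigma> (q - free_const k) = S3_act \<sigma> q - free_const k" for q q' :: "'a free_alg" and k
    by (simp_all add: S3_act_def free_hom_add free_hom_diff)
  have "inj (perm_gen \<sigma>)"
  proof (rule injI)
    fix x y assume "perm_gen \<sigma> x = perm_gen \<sigma> y"
    then have "\<sigma> (gen_index x) = \<sigma> (gen_index y)" using gen_index_perm_gen[OF assms(1)] by metis
    then show "x = y" using permutes_inj[OF assms(1)] by (simp add: inj_eq)
  qed
  then have "perm_gen \<sigma> Gen_a \<noteq> perm_gen \<sigma> Gen_b" "perm_gen \<sigma> Gen_a \<noteq> perm_gen \<sigma> Gen_c"
    "perm_gen \<sigma> Gen_b \<noteq> perm_gen \<sigma> Gen_c"
    by (simp_all add: inj_eq)
  note distinct = this this[symmetric]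
  have "(free_var Gen_c * free_var Gen_b + free_var Gen_b * free_var Gen_a + free_var Gen_a * free_var Gen_c :: 'a free_alg)
    = free_var Gen_c * free_var Gen_b + free_var Gen_a * free_var Gen_c + free_var Gen_b * free_var Gen_a"
    by (simp only: add.assoc add.commute add.left_commute)
  with assms(2) consider x where "r = free_var x * free_var x - free_const \<gamma>1"
    | "r = free_var Gen_c * free_var Gen_a + free_var Gen_b * free_var Gen_c
        + free_var Gen_a * free_var Gen_b - free_const \<gamma>2"
    | "r = free_var Gen_c * free_var Gen_b + free_var Gen_a * free_var Gen_c
        + free_var Gen_b * free_var Gen_a - free_const \<gamma>2"
    unfolding D3_relators_def Let_def insert_iff empty_iff by metis
  then show ?thesis
  proof cases
    case 1
    then show ?thesis using D3_relators_square by (simp only: hom prod)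
  next
    case 2
    have "?p Gen_a \<noteq> ?p Gen_b" "?p Gen_a \<noteq> ?p Gen_c" "?p Gen_b \<noteq> ?p Gen_c"
      using distinct by auto
    from D3_relators_triangle[OF this] show ?thesis by (simp only: 2 hom prod)
  next
    case 3
    have "?p Gen_b \<noteq> ?p Gen_a" "?p Gen_b \<noteq> ?p Gen_c" "?p Gen_a \<noteq> ?p Gen_c"
      using distinct by auto
    from D3_relators_triangle[OF this] show ?thesis by (simp only: 3 hom prod)
  qed
qed

lemma D3_filtered:
  "filtered_module_algebra (sym_group 3) (ring_of_type_algebra :: 'k::field ring) (D3 \<gamma>1 (\<gamma>2 :: 'k))"
proof -
  let ?A = "free_filtered :: (nat \<Rightarrow> nat, 'k, 'k free_alg) module_alg"
  interpret A: filtered_module_algebra "sym_group 3" "ring_of_type_algebra :: 'k ring" ?A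
    by (rule filtered_free)
  let ?S = "D3_relators \<gamma>1 \<gamma>2" and ?I = "Idl\<^bsub>?A\<^esub> D3_relators \<gamma>1 \<gamma>2"
  have carr: "carrier ?A = UNIV" by (simp add: free_filtered_def)
  have I: "ideal ?I ?A" by (rule A.genideal_ideal) (simp add: carr)
  have "act ?A \<sigma> x \<in> ?I" if \<sigma>: "\<sigma> \<in> carrier (sym_group 3)" and x: "x \<in> ?I" for \<sigma> x
  proof -
    have hom: "act ?A \<sigma> \<in> ring_hom ?A ?A"
      using \<sigma> by (intro ring_hom_memI) (auto simp: A.act_closed A.act_add A.act_times A.act_unit)
    then have "ring_hom_ring ?A ?A (act ?A \<sigma>)"
      by (intro ring_hom_ringI2 A.ring_axioms)
    then have "ideal {y \<in> carrier ?A. act ?A \<sigma> y \<in> ?I} ?A"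
      using ring_hom_ring.ideal_vimage I by blast
    moreover have "?S \<subseteq> {y \<in> carrier ?A. act ?A \<sigma> y \<in> ?I}"
    proof
      fix r assume "r \<in> ?S"
      then have "act ?A \<sigma> r \<in> ?S"
        using \<sigma> D3_relators_act by (simp add: free_filtered_def sym_group_carrier)
      then show "r \<in> {y \<in> carrier ?A. act ?A \<sigma> y \<in> ?I}"
        using A.genideal_self[of ?S] by (auto simp: carr)
    qed
    ultimately show ?thesis
      using A.genideal_minimal x by blast
  qed
  with I show ?thesis unfolding D3_def by (intro filtered_quotient_alg filtered_free)
qed

end

(*
  A PBW deformation D inherits generators a, b, c from gr D = E3: a lift of a can be averaged over its
  stabiliser {id, (23)}, as the characteristic is not 2, and its translates give an equivariant
  surjection from the free algebra onto D. Let N be the kernel. The leading forms of elements of N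
  are the homogeneous elements of the ideal I0 of relations of E3, so each quadratic relation of E3
  deforms to an element of N by terms of degree at most 1. Invariance under S3 leaves
    a^2 = k + beta (b - c),
    ca + bc + ab = l + alpha (a + b + c),  cb + ba + ac = l - alpha (a + b + c),
  and overlaps of these relations produce quadratic elements of N that do not lie in I0 unless
  beta = 0 and then alpha = 0. So N contains the relators of D_3(k, l), and induction on the degree,
  cancelling leading forms, shows that they generate it.
*)

theory Submission
  imports Defs
begin


section \<open>Two-sided ideals and homogeneous components of the free algebra\<close>

text \<open>Neither a basis nor the dimension of \<open>E3\<close> is computed. Matching leading
  forms has two halves. That the homogeneous parts of elements of I0 extend by lower terms to
  elements of \<open>FK_ideal \<gamma>1 \<gamma>2\<close> is formal and holds for all parameters
  (\<open>FK_ideal_part\<close>). That the kernel has no further leading forms would ordinarily be a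
  confluence statement; here it is the hypothesis on gr D. It also lets the unwanted linear terms be
  excluded with knowledge of I0 in degrees at most 2 only: cubic words cancel in the overlaps, and
  one linear functional is evaluated on the quadratic rest. It returns the unknown coefficient up to
  sign, so the overlaps impose no condition on the characteristic. Division by 2 occurs in the
  averaging and in excluding the term in a from the relation for a^2. Since D comes without a
  presentation, the argument is carried out for subsets of \<open>'k free_alg\<close>, where type
  class arithmetic is available; D enters it through \<open>FK_deformation_ker\<close>.\<close>

definition free_ideal :: "'k::field free_alg set \<Rightarrow> bool"
  where "free_ideal J \<longleftrightarrow> 0 \<in> J \<and> (\<forall>x\<in>J. \<forall>y\<in>J. x + y \<in> J) \<and> (\<forall>p. \<forall>x\<in>J. p * x \<in> J \<and> x * p \<in> J)"

lemma free_idealI: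
  assumes "0 \<in> J" "\<And>x y. \<lbrakk>x \<in> J; y \<in> J\<rbrakk> \<Longrightarrow> x + y \<in> J"
    and "\<And>p x. x \<in> J \<Longrightarrow> p * x \<in> J" "\<And>p x. x \<in> J \<Longrightarrow> x * p \<in> J"
  shows "free_ideal J"
  using assms unfolding free_ideal_def by blast

lemma
  assumes "free_ideal J"
  shows free_ideal_zero: "0 \<in> J"
    and free_ideal_add: "\<And>x y. \<lbrakk>x \<in> J; y \<in> J\<rbrakk> \<Longrightarrow> x + y \<in> J"
    and free_ideal_mult_left: "\<And>p x. x \<in> J \<Longrightarrow> p * x \<in> J"
    and free_ideal_mult_right: "\<And>p x. x \<in> J \<Longrightarrow> x * p \<in> J"
  using assms unfolding free_ideal_def by blast+

lemma free_ideal_uminus: "\<lbrakk>free_ideal J; x \<in> J\<rbrakk> \<Longrightarrow> - x \<in> J"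
  using free_ideal_mult_left[of J x "- 1"] by simp

lemma free_ideal_diff: "\<lbrakk>free_ideal J; x \<in> J; y \<in> J\<rbrakk> \<Longrightarrow> x - y \<in> J"
  using free_ideal_add[of J x "- y"] free_ideal_uminus[of J y] by simp

lemma free_filtered_simps:
  "carrier free_filtered = UNIV" "monoid.mult free_filtered = (*)" "one free_filtered = 1"
  "ring.zero free_filtered = 0" "ring.add free_filtered = (+)"
  "module.smult free_filtered = (\<lambda>k p. free_const k * p)" "act free_filtered = S3_act"
  "piece free_filtered n = free_upto n"
  by (simp_all add: free_filtered_def free_upto_def)

text \<open>Bridge from record-based ideals to type class arithmetic. Closure under negation is
  implicit in \<open>free_ideal\<close>, through multiplication by \<open>- 1\<close>.\<close>

lemma ideal_free_filtered: "ideal J (free_filtered :: (nat \<Rightarrow> nat, 'k::field, 'k free_alg) module_alg) \<longleftrightarrow> free_ideal J"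
  (is "ideal J ?A \<longleftrightarrow> _")
proof
  interpret A: filtered_module_algebra "sym_group 3" "ring_of_type_algebra :: 'k ring" ?A
    by (rule filtered_free)
  show "free_ideal J" if "ideal J ?A"
  proof -
    interpret ideal J ?A by fact
    show ?thesis
      using zero_closed a_closed I_l_closed I_r_closed
      by (intro free_idealI) (auto simp: free_filtered_simps)
  qed
  show "ideal J ?A" if J: "free_ideal J"
  proof (rule idealI[OF A.ring_axioms])
    have inv: "inv\<^bsub>add_monoid ?A\<^esub> x = - x" for x :: "'k free_alg"
      using A.minus_equality[of "- x" x] by (simp add: free_filtered_simps a_inv_def)
    show "subgroup J (add_monoid ?A)"
    proof (rule subgroup.intro)
      show "inv\<^bsub>add_monoid ?A\<^esub> x \<in> J" if "x \<in> J" for x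
        unfolding inv using J that by (rule free_ideal_uminus)
    qed (use J in \<open>auto simp: free_filtered_simps free_ideal_zero free_ideal_add\<close>)
  qed (use J in \<open>auto simp: free_filtered_simps free_ideal_mult_left free_ideal_mult_right\<close>)
qed

text \<open>The two records differ only in \<open>piece\<close>, which the notion of ideal does not
  see.\<close>

lemma ideal_free_graded: "ideal J free_graded \<longleftrightarrow> ideal J free_filtered"
  by (simp add: free_graded_def ideal_def ideal_axioms_def additive_subgroup_def ring_def
      abelian_group_def abelian_group_axioms_def abelian_monoid_def comm_group_def
      ring_axioms_def monoid_def free_filtered_def subgroup_def m_inv_def Units_def
      comm_monoid_def comm_monoid_axioms_def group_def group_axioms_def)

section \<open>The ideals of relations of \<open>D3\<close> and \<open>E3\<close>\<close>

definition FK_ideal :: "'k::field \<Rightarrow> 'k \<Rightarrow> 'k free_alg set"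
  where "FK_ideal \<gamma>1 \<gamma>2 = Idl\<^bsub>free_filtered\<^esub> D3_relators \<gamma>1 \<gamma>2"

lemma genideal_free_graded: "Idl\<^bsub>free_graded\<^esub> D3_relators \<gamma>1 \<gamma>2 = FK_ideal \<gamma>1 \<gamma>2"
  by (simp add: FK_ideal_def genideal_def ideal_free_graded)

lemma FK_ideal_ideal: "free_ideal (FK_ideal \<gamma>1 (\<gamma>2 :: 'k::field))"
proof -
  interpret A: filtered_module_algebra "sym_group 3" "ring_of_type_algebra :: 'k ring"
    "free_filtered :: (nat \<Rightarrow> nat, 'k, 'k free_alg) module_alg"
    by (rule filtered_free)
  show ?thesis
    unfolding FK_ideal_def ideal_free_filtered[symmetric]
    by (rule A.genideal_ideal) (simp add: free_filtered_simps)
qed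

lemma FK_ideal_minimal: "\<lbrakk>free_ideal J; D3_relators \<gamma>1 \<gamma>2 \<subseteq> J\<rbrakk> \<Longrightarrow> FK_ideal \<gamma>1 \<gamma>2 \<subseteq> J"
  unfolding FK_ideal_def genideal_def by (auto simp: ideal_free_filtered)

lemma D3_relators_in_FK_ideal: "D3_relators \<gamma>1 \<gamma>2 \<subseteq> FK_ideal \<gamma>1 \<gamma>2"
  unfolding FK_ideal_def genideal_def by auto

section \<open>Homogeneous parts and the filtration by word length\<close>

definition free_homog :: "nat \<Rightarrow> 'k::field free_alg set"
  where "free_homog n = {p. \<forall>w\<in>Poly_Mapping.keys p. length (letters w) = n}"

text \<open>The bound is strict so that degree 0 gives only 0. This parallels \<open>lower\<close>
  and lets inductions on the degree start from the zero space.\<close>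

definition free_below :: "nat \<Rightarrow> 'k::field free_alg set"
  where "free_below n = {p. \<forall>w\<in>Poly_Mapping.keys p. length (letters w) < n}"

definition free_part :: "nat \<Rightarrow> 'k::field free_alg \<Rightarrow> 'k free_alg"
  where "free_part n p = Abs_poly_mapping (\<lambda>w. Poly_Mapping.lookup p w when length (letters w) = n)"

lemma lookup_free_part:
  "Poly_Mapping.lookup (free_part n p) w = (Poly_Mapping.lookup p w when length (letters w) = n)"
proof -
  have "finite {w. (Poly_Mapping.lookup p w when length (letters w) = n) \<noteq> 0}"
    by (rule finite_subset[OF _ finite_keys[of p]]) (auto simp: in_keys_iff)
  then show ?thesis by (simp add: free_part_def)
qed

lemma free_part_0 [simp]: "free_part n 0 = 0"
  and free_part_add: "free_part n (p + q) = free_part n p + free_part n q"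
  by (rule poly_mapping_eqI; simp add: lookup_free_part lookup_add when_def)+

lemma free_part_single:
  "free_part n (Poly_Mapping.single w k) = (if length (letters w) = n then Poly_Mapping.single w k else 0)"
  by (rule poly_mapping_eqI) (auto simp: lookup_free_part lookup_single when_def)

lemma free_part_homog: "free_part n p \<in> free_homog n"
  by (auto simp: free_homog_def in_keys_iff lookup_free_part)

lemma free_part_of_homog: "p \<in> free_homog n \<Longrightarrow> free_part n p = p"
  by (rule poly_mapping_eqI) (auto simp: free_homog_def lookup_free_part when_def in_keys_iff)

lemma free_part_of_homog_neq: "\<lbrakk>p \<in> free_homog m; m \<noteq> n\<rbrakk> \<Longrightarrow> free_part n p = 0"
  by (rule poly_mapping_eqI) (auto simp: free_homog_def lookup_free_part when_def in_keys_iff)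

lemma free_part_below:
  assumes "p \<in> free_upto n"
  shows "p - free_part n p \<in> free_below n"
  unfolding free_below_def
proof safe
  fix w assume w: "w \<in> Poly_Mapping.keys (p - free_part n p)"
  then have "w \<in> Poly_Mapping.keys p" and "length (letters w) \<noteq> n"
    by (cases "length (letters w) = n"; simp add: in_keys_iff lookup_minus lookup_free_part)+
  with assms show "length (letters w) < n"
    by (auto simp: free_upto_def le_less)
qed

lemma free_below_0: "free_below 0 = {0}"
  by (auto simp: free_below_def)

lemma free_below_Suc: "free_below (Suc n) = free_upto n"
  by (simp add: free_below_def free_upto_def less_Suc_eq_le)

lemma free_below_zero: "0 \<in> free_below n"
  by (simp add: free_below_def)

lemma free_below_add: "\<lbrakk>p \<in> free_below n; q \<in> free_below n\<rbrakk> \<Longrightarrow> p + q \<in> free_below n"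
  by (cases n) (simp_all add: free_below_0 free_below_Suc free_upto_add)

lemma free_below_uminus: "p \<in> free_below n \<Longrightarrow> - p \<in> free_below n"
  by (simp add: free_below_def)

lemma free_below_mult_left: "\<lbrakk>p \<in> free_upto m; q \<in> free_below n\<rbrakk> \<Longrightarrow> p * q \<in> free_below (m + n)"
  by (cases n) (simp_all add: free_below_0 free_below_zero free_below_Suc free_upto_mult)

lemma free_below_mult_right: "\<lbrakk>p \<in> free_below m; q \<in> free_upto n\<rbrakk> \<Longrightarrow> p * q \<in> free_below (m + n)"
  by (cases m) (simp_all add: free_below_0 free_below_zero free_below_Suc free_upto_mult)

lemma free_upto_single: "Poly_Mapping.single w k \<in> free_upto (length (letters w))"
  by (simp add: free_upto_def)

lemma free_homog_zero: "0 \<in> free_homog n"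
  by (simp add: free_homog_def)

lemma free_homog_add: "\<lbrakk>p \<in> free_homog n; q \<in> free_homog n\<rbrakk> \<Longrightarrow> p + q \<in> free_homog n"
  using Poly_Mapping.keys_add[of p q] by (auto simp: free_homog_def)

lemma free_homog_uminus: "p \<in> free_homog n \<Longrightarrow> - p \<in> free_homog n"
  by (simp add: free_homog_def)

lemma free_homog_diff: "\<lbrakk>p \<in> free_homog n; q \<in> free_homog n\<rbrakk> \<Longrightarrow> p - q \<in> free_homog n"
  using free_homog_add[of p n "- q"] by (simp add: free_homog_uminus)

lemma free_homog_mult: "\<lbrakk>p \<in> free_homog m; q \<in> free_homog n\<rbrakk> \<Longrightarrow> p * q \<in> free_homog (m + n)"
  using Poly_Mapping.keys_mult[of p q] by (fastforce simp: free_homog_def plus_word_def)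

lemma free_homog_const: "free_const k \<in> free_homog 0"
  by (auto simp: free_homog_def free_const_def zero_word_def)

lemma free_homog_var: "free_var x \<in> free_homog 1"
  by (auto simp: free_homog_def free_var_def)

lemma free_homog_const_mult: "p \<in> free_homog n \<Longrightarrow> free_const k * p \<in> free_homog n"
  using free_homog_mult[OF free_homog_const] by fastforce

lemma free_homog_upto: "free_homog n \<subseteq> free_upto n"
  by (auto simp: free_homog_def free_upto_def)

lemma free_upto_1E:
  assumes "p \<in> free_upto 1"
  obtains k \<alpha> \<beta> \<gamma> where "p = free_const k + free_const \<alpha> * free_var Gen_a
    + free_const \<beta> * free_var Gen_b + free_const \<gamma> * free_var Gen_c"
proof
  let ?k = "\<lambda>xs. Poly_Mapping.lookup p (Word xs)"
  have const: "free_const k = Poly_Mapping.single (Word []) k" for k :: 'a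
    by (simp only: free_const_def zero_word_def)
  have var: "free_const k * free_var x = Poly_Mapping.single (Word [x]) k" for k :: 'a and x
    by (simp add: free_const_def free_var_def mult_single)
  have "Poly_Mapping.lookup p w = Poly_Mapping.lookup (Poly_Mapping.single (Word []) (?k []) +
      Poly_Mapping.single (Word [Gen_a]) (?k [Gen_a]) + Poly_Mapping.single (Word [Gen_b]) (?k [Gen_b]) +
      Poly_Mapping.single (Word [Gen_c]) (?k [Gen_c])) w" for w
  proof (cases "w \<in> {Word [], Word [Gen_a], Word [Gen_b], Word [Gen_c]}")
    case True
    then show ?thesis
      by (elim insertE emptyE) (simp_all add: lookup_add lookup_single)
  next
    case False
    have "w \<notin> Poly_Mapping.keys p"
    proof
      assume "w \<in> Poly_Mapping.keys p"
      with assms have "length (letters w) \<le> 1" by (simp add: free_upto_def)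
      then have "length (letters w) = 0 \<or> length (letters w) = 1" by linarith
      then consider "letters w = []" | x where "letters w = [x]"
        by (auto simp: length_Suc_conv)
      then show False
      proof cases
        case 1
        with False show False by (cases w) simp
      next
        case 2
        with False show False by (cases w; cases x) simp_all
      qed
    qed
    then have "Poly_Mapping.lookup p w = 0" by (simp add: in_keys_iff)
    with False show ?thesis by (simp add: lookup_add lookup_single when_def)
  qed
  then have "p = Poly_Mapping.single (Word []) (?k []) +
      Poly_Mapping.single (Word [Gen_a]) (?k [Gen_a]) + Poly_Mapping.single (Word [Gen_b]) (?k [Gen_b]) +
      Poly_Mapping.single (Word [Gen_c]) (?k [Gen_c])"
    by (rule poly_mapping_eqI)
  then show "p = free_const (?k []) + free_const (?k [Gen_a]) * free_var Gen_a
    + free_const (?k [Gen_b]) * free_var Gen_b + free_const (?k [Gen_c]) * free_var Gen_c"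
    unfolding var unfolding const .
qed

text \<open>Multiplication by a monomial shifts degrees, and every element is a sum of monomials.
  The case distinction guards against truncated subtraction when the word is longer than
  \<open>n\<close>.\<close>

lemma free_part_single_mult_left:
  "free_part n (Poly_Mapping.single w k * p) =
    (if length (letters w) \<le> n then Poly_Mapping.single w k * free_part (n - length (letters w)) p else 0)"
proof (induction p rule: free_induct)
  case (single v l)
  then show ?case by (auto simp: mult_single free_part_single plus_word_def)
next
  case (sum p q)
  then show ?case by (simp add: distrib_left free_part_add)
qed

lemma free_part_single_mult_right:
  "free_part n (p * Poly_Mapping.single w k) =
    (if length (letters w) \<le> n then free_part (n - length (letters w)) p * Poly_Mapping.single w k else 0)"
proof (induction p rule: free_induct)
  case (single v l)
  then show ?case by (auto simp: mult_single free_part_single plus_word_def)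
next
  case (sum p q)
  then show ?case by (simp add: distrib_right free_part_add)
qed

section \<open>Leading forms and low coefficients of the ideals of relations\<close>

lemma D3_relators_split:
  assumes "r \<in> D3_relators (0::'k::field) 0"
  shows "r \<in> free_homog 2" and "\<exists>k. r - free_const k \<in> D3_relators \<gamma>1 \<gamma>2"
proof -
  have "free_var x * free_var y \<in> (free_homog 2 :: 'k free_alg set)" for x y
    using free_homog_mult[OF free_homog_var free_homog_var, of x y] by (simp add: numeral_2_eq_2)
  with assms show "r \<in> free_homog 2"
    by (auto simp: D3_relators_def Let_def free_homog_add)
  show "\<exists>k. r - free_const k \<in> D3_relators \<gamma>1 \<gamma>2"
    using assms by (auto simp: D3_relators_def Let_def)
qed

text \<open>In an expression of \<open>p\<close> through the homogeneous relators, replacing each of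
  them by its deformed version alters every homogeneous part by terms of smaller degree only.
  Nothing is claimed about other leading forms of the deformed ideal, so no confluence is
  involved.\<close>

lemma FK_ideal_part:
  assumes "p \<in> FK_ideal (0::'k::field) 0"
  shows "\<exists>q\<in>free_below n. free_part n p - q \<in> FK_ideal \<gamma>1 \<gamma>2"
proof -
  let ?J = "FK_ideal \<gamma>1 \<gamma>2"
  \<comment> \<open>All degrees at once: multiplication by a word shifts the degree, so a fixed
    \<open>n\<close> would not define an ideal.\<close>
  define S where "S = {p :: 'k free_alg. \<forall>n. \<exists>q\<in>free_below n. free_part n p - q \<in> ?J}"
  note J = FK_ideal_ideal[of \<gamma>1 \<gamma>2]
  have add: "p + q \<in> S" if "p \<in> S" "q \<in> S" for p q
    unfolding S_def
  proof safe
    fix n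
    from that obtain p' q' where "p' \<in> free_below n" "free_part n p - p' \<in> ?J"
      "q' \<in> free_below n" "free_part n q - q' \<in> ?J"
      unfolding S_def by blast
    moreover have "free_part n (p + q) - (p' + q') = (free_part n p - p') + (free_part n q - q')"
      by (simp add: free_part_add)
    ultimately show "\<exists>r\<in>free_below n. free_part n (p + q) - r \<in> ?J"
      using free_ideal_add[OF J] free_below_add by metis
  qed
  have left: "Poly_Mapping.single w k * p \<in> S" if "p \<in> S" for p w k
    unfolding S_def
  proof safe
    fix n
    let ?w = "Poly_Mapping.single w k" and ?l = "length (letters w)"
    show "\<exists>q\<in>free_below n. free_part n (?w * p) - q \<in> ?J"
    proof (cases "?l \<le> n")
      case True
      from that obtain q where q: "q \<in> free_below (n - ?l)" "free_part (n - ?l) p - q \<in> ?J"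
        unfolding S_def by blast
      have "?w * q \<in> free_below n"
        using free_below_mult_left[OF free_upto_single q(1), of w k] True by simp
      moreover have "?w * free_part (n - ?l) p - ?w * q \<in> ?J"
        using free_ideal_mult_left[OF J q(2), of ?w] by (simp add: right_diff_distrib)
      ultimately show ?thesis using True by (auto simp: free_part_single_mult_left)
    next
      case False
      then show ?thesis
        using free_ideal_zero[OF J] by (auto simp: free_part_single_mult_left intro!: bexI[of _ 0] free_below_zero)
    qed
  qed
  have right: "p * Poly_Mapping.single w k \<in> S" if "p \<in> S" for p w k
    unfolding S_def
  proof safe
    fix n
    let ?w = "Poly_Mapping.single w k" and ?l = "length (letters w)"
    show "\<exists>q\<in>free_below n. free_part n (p * ?w) - q \<in> ?J"
    proof (cases "?l \<le> n")
      case True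
      from that obtain q where q: "q \<in> free_below (n - ?l)" "free_part (n - ?l) p - q \<in> ?J"
        unfolding S_def by blast
      have "q * ?w \<in> free_below n"
        using free_below_mult_right[OF q(1) free_upto_single, of w k] True by simp
      moreover have "free_part (n - ?l) p * ?w - q * ?w \<in> ?J"
        using free_ideal_mult_right[OF J q(2), of ?w] by (simp add: left_diff_distrib)
      ultimately show ?thesis using True by (auto simp: free_part_single_mult_right)
    next
      case False
      then show ?thesis
        using free_ideal_zero[OF J] by (auto simp: free_part_single_mult_right intro!: bexI[of _ 0] free_below_zero)
    qed
  qed
  have "free_ideal S"
  proof (rule free_idealI[OF _ add])
    show "0 \<in> S"
      using free_ideal_zero[OF J] by (auto simp: S_def intro!: bexI[of _ 0] free_below_zero)
    show "q * p \<in> S" if "p \<in> S" for p q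
      by (induction q rule: free_induct) (simp_all add: left that distrib_right add)
    show "p * q \<in> S" if "p \<in> S" for p q
      by (induction q rule: free_induct) (simp_all add: right that distrib_left add)
  qed auto
  moreover have "D3_relators 0 0 \<subseteq> S"
  proof
    fix r :: "'k free_alg" assume r: "r \<in> D3_relators 0 0"
    have r2: "r \<in> free_homog 2" by (rule D3_relators_split(1)[OF r])
    obtain k where k: "r - free_const k \<in> ?J"
      using D3_relators_split(2)[OF r] D3_relators_in_FK_ideal by blast
    have "free_const k \<in> free_below 2"
      by (auto simp: free_below_def free_const_def zero_word_def)
    then have "\<exists>q\<in>free_below n. free_part n r - q \<in> ?J" for n
    proof (cases "n = 2")
      case True
      with \<open>free_const k \<in> free_below 2\<close> k show ?thesis
        by (auto simp: free_part_of_homog[OF r2])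
    next
      case False
      with free_part_of_homog_neq[OF r2, of n] free_ideal_zero[OF J] show ?thesis
        by (auto intro!: bexI[of _ 0] free_below_zero)
    qed
    then show "r \<in> S" unfolding S_def by blast
  qed
  ultimately have "FK_ideal 0 0 \<subseteq> S" by (rule FK_ideal_minimal)
  with assms show ?thesis unfolding S_def by blast
qed

text \<open>The three conditions together cut out an ideal: if \<open>p\<close> has no terms of
  length at most 1, then its product with a nonempty word has no terms of length at most 2, and the
  last equation becomes 0 = 0. The relators satisfy it because \<open>bc\<close> and
  \<open>ab\<close> appear in the same one, with equal coefficients.\<close>

lemma FK_ideal_lookup:
  assumes "p \<in> FK_ideal (0::'k::field) 0"
  shows "Poly_Mapping.lookup p (Word []) = 0" "Poly_Mapping.lookup p (Word [x]) = 0"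
    "Poly_Mapping.lookup p (Word [Gen_b, Gen_c]) = Poly_Mapping.lookup p (Word [Gen_a, Gen_b])"
proof -
  let ?l = "Poly_Mapping.lookup :: 'k free_alg \<Rightarrow> word \<Rightarrow> 'k"
  define S where "S = {p. ?l p (Word []) = 0 \<and> (\<forall>x. ?l p (Word [x]) = 0) \<and>
    ?l p (Word [Gen_b, Gen_c]) = ?l p (Word [Gen_a, Gen_b])}"
  have add: "p + q \<in> S" if "p \<in> S" "q \<in> S" for p q
    using that by (simp add: S_def lookup_add)
  have single_left: "?l (Poly_Mapping.single (Word vs) k * Poly_Mapping.single w l) (Word us) =
    (if w = Word (drop (length vs) us) \<and> take (length vs) us = vs then k * l else 0)" for vs w us and k l
    by (cases w) (auto simp: mult_single plus_word_def lookup_single when_def append_eq_conv_conj)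
  have left_lookup: "?l (Poly_Mapping.single (Word vs) k * p) (Word us) =
    (if take (length vs) us = vs then k * ?l p (Word (drop (length vs) us)) else 0)" for vs us k p
  proof (induction p rule: free_induct)
    case (single w l)
    show ?case by (auto simp: single_left lookup_single when_def)
  next
    case (sum p q)
    then show ?case by (simp add: distrib_left lookup_add)
  qed
  have single_right: "?l (Poly_Mapping.single w l * Poly_Mapping.single (Word vs) k) (Word us) =
    (if \<exists>ys. us = ys @ vs \<and> w = Word ys then l * k else 0)" for vs w us and k l
    by (cases w) (auto simp: mult_single plus_word_def lookup_single when_def)
  have right_lookup: "?l (p * Poly_Mapping.single (Word vs) k) (Word us) =
    (if \<exists>ys. us = ys @ vs then ?l p (Word (take (length us - length vs) us)) * k else 0)" for vs us k p
  proof (induction p rule: free_induct)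
    case (single w l)
    show ?case by (auto simp: single_right lookup_single when_def)
  next
    case (sum p q)
    then show ?case by (simp add: distrib_right lookup_add)
  qed
  have left: "Poly_Mapping.single v k * p \<in> S" if "p \<in> S" for p v k
  proof (cases v)
    case (Word vs)
    \<comment> \<open>A factor of length 0, 1 or at least 2 leaves a coefficient of \<open>p\<close>
      at a word of length at most 2, 1 or 0.\<close>
    consider "vs = []" | x where "vs = [x]" | x y zs where "vs = x # y # zs"
      by (cases vs; cases "tl vs") auto
    then show ?thesis using that Word
      by cases (auto simp: S_def left_lookup)
  qed
  have right: "p * Poly_Mapping.single v k \<in> S" if "p \<in> S" for p v k
  proof (cases v)
    case (Word vs)
    consider "vs = []" | x where "vs = [x]" | x y zs where "vs = x # y # zs"
      by (cases vs; cases "tl vs") auto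
    then show ?thesis using that Word
      by cases (auto simp: S_def right_lookup Cons_eq_append_conv)
  qed
  have "free_ideal S"
  proof (rule free_idealI[OF _ add])
    show "0 \<in> S" by (simp add: S_def)
    show "q * p \<in> S" if "p \<in> S" for p q
      by (induction q rule: free_induct) (simp_all add: left that distrib_right add)
    show "p * q \<in> S" if "p \<in> S" for p q
      by (induction q rule: free_induct) (simp_all add: right that distrib_left add)
  qed auto
  moreover have "D3_relators 0 0 \<subseteq> S"
    by (auto simp: D3_relators_def Let_def S_def free_var_def mult_single plus_word_def lookup_add
        lookup_single when_def)
  ultimately have "FK_ideal 0 0 \<subseteq> S" by (rule FK_ideal_minimal)
  with assms show "?l p (Word []) = 0" "?l p (Word [x]) = 0"
    "?l p (Word [Gen_b, Gen_c]) = ?l p (Word [Gen_a, Gen_b])"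
    unfolding S_def by blast+
qed


section \<open>Deformations of the relations\<close>

text \<open>
  The words \<open>bc\<close> and \<open>ab\<close> occur in the same quadratic relation of \<open>E3\<close> with coefficient 1, so the
  functional vanishes on all quadratic relations. It is nonzero on the expressions that the two lemmas
  on relations below produce from unwanted linear terms.
\<close>

definition FK_functional :: "'k::field free_alg \<Rightarrow> 'k"
  where "FK_functional p = Poly_Mapping.lookup p (Word [Gen_b, Gen_c]) - Poly_Mapping.lookup p (Word [Gen_a, Gen_b])"

lemma FK_functional_simps:
  "FK_functional (p + q) = FK_functional p + FK_functional q"
  "FK_functional (p - q) = FK_functional p - FK_functional q"
  "FK_functional (- p) = - FK_functional p"
  "FK_functional (free_const k * p) = k * FK_functional p"
  "FK_functional (free_var x * free_var y) =
    (if x = Gen_b \<and> y = Gen_c then 1 else if x = Gen_a \<and> y = Gen_b then - 1 else 0)"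
proof -
  have "Poly_Mapping.lookup (free_const k * p) w = k * Poly_Mapping.lookup p w" for p :: "'a free_alg" and k w
    by (induction p rule: free_induct)
      (auto simp: free_const_def mult_single lookup_single distrib_left lookup_add when_def)
  then show "FK_functional (free_const k * p) = k * FK_functional p"
    by (simp add: FK_functional_def right_diff_distrib)
qed (auto simp: FK_functional_def lookup_add lookup_minus free_var_def mult_single plus_word_def lookup_single)

lemma S3_act_hom:
  "S3_act \<sigma> (p + q) = S3_act \<sigma> p + S3_act \<sigma> q" "S3_act \<sigma> (p - q) = S3_act \<sigma> p - S3_act \<sigma> q"
  "S3_act \<sigma> (p * q) = S3_act \<sigma> p * S3_act \<sigma> q" "S3_act \<sigma> (- p) = - S3_act \<sigma> p"
  "S3_act \<sigma> (free_const k) = free_const k"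
  by (simp_all add: S3_act_def free_hom_add free_hom_diff free_hom_mult free_hom_uminus)

text \<open>
  \<open>N\<close> abstracts the kernel of a presentation of a PBW deformation: its leading forms are exactly the
  homogeneous elements of the ideal of relations of \<open>E3\<close>.
\<close>

locale FK_deformation =
  fixes N :: "'k::field free_alg set"
  assumes two: "(2 :: 'k) \<noteq> 0"
    and ideal: "free_ideal N"
    and act: "\<lbrakk>\<sigma> permutes {1..3}; p \<in> N\<rbrakk> \<Longrightarrow> S3_act \<sigma> p \<in> N"
    and leading: "\<lbrakk>p \<in> N; p \<in> free_upto n\<rbrakk> \<Longrightarrow> free_part n p \<in> FK_ideal 0 0"
    and lift: "\<lbrakk>p \<in> FK_ideal 0 0; p \<in> free_homog n\<rbrakk> \<Longrightarrow> \<exists>q\<in>free_below n. p - q \<in> N"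
begin

abbreviation "a \<equiv> free_var Gen_a :: 'k free_alg"
abbreviation "b \<equiv> free_var Gen_b :: 'k free_alg"
abbreviation "c \<equiv> free_var Gen_c :: 'k free_alg"
abbreviation K :: "'k \<Rightarrow> 'k free_alg" where "K \<equiv> free_const"

lemmas add_N = free_ideal_add[OF ideal]
  and diff_N = free_ideal_diff[OF ideal] and left_N = free_ideal_mult_left[OF ideal]
  and right_N = free_ideal_mult_right[OF ideal]

text \<open>I0 is zero in degrees 0 and 1, so 1 and the generators remain linearly independent
  modulo \<open>N\<close>. This permits comparing coefficients of two lifts of the same quadratic
  form.\<close>

lemma coefficients_zero:
  assumes "K k + K \<alpha> * a + K \<beta> * b + K \<gamma> * c \<in> N"
  shows "k = 0" "\<alpha> = 0" "\<beta> = 0" "\<gamma> = 0"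
proof -
  let ?p = "K k + K \<alpha> * a + K \<beta> * b + K \<gamma> * c"
  have K0: "K k \<in> free_homog 0" by (rule free_homog_const)
  have h1: "K \<alpha> * a + K \<beta> * b + K \<gamma> * c \<in> free_homog 1"
    by (intro free_homog_add free_homog_const_mult free_homog_var)
  have u: "K k \<in> free_upto n" for n
    using free_upto_const free_upto_mono[of 0 n] by blast
  have "?p \<in> free_upto 1"
    using free_upto_add[OF u subsetD[OF free_homog_upto h1]] by (simp add: add.assoc)
  from leading[OF assms this]
  have "free_part 1 (K k + (K \<alpha> * a + K \<beta> * b + K \<gamma> * c)) \<in> FK_ideal 0 0" by (simp add: add.assoc)
  then have I: "K \<alpha> * a + K \<beta> * b + K \<gamma> * c \<in> FK_ideal 0 0"
    using free_part_of_homog[OF h1] free_part_of_homog_neq[OF K0, of 1] unfolding free_part_add by simp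
  have look: "Poly_Mapping.lookup (K \<kappa> * free_var x) (Word [y]) = (if x = y then \<kappa> else 0)" for \<kappa> x y
    by (simp add: free_const_def free_var_def mult_single lookup_single)
  show "\<alpha> = 0" "\<beta> = 0" "\<gamma> = 0"
    using FK_ideal_lookup(2)[OF I, of Gen_a] FK_ideal_lookup(2)[OF I, of Gen_b] FK_ideal_lookup(2)[OF I, of Gen_c]
    by (simp_all add: lookup_add look)
  \<comment> \<open>With the linear part gone, the constant has become a leading form, now of degree
    0.\<close>
  with assms have "K k \<in> N" by simp
  from leading[OF this u[of 0]] have "K k \<in> FK_ideal 0 0"
    by (simp add: free_part_of_homog[OF K0])
  from FK_ideal_lookup(1)[OF this] show "k = 0"
    by (simp add: free_const_def lookup_single zero_word_def)
qed

text \<open>A homogeneous element of \<open>N\<close> is its own leading form and hence lies in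
  I0.\<close>

lemma functional_zero:
  assumes "p \<in> N" "p \<in> free_homog 2"
  shows "FK_functional p = 0"
proof -
  have "p \<in> FK_ideal 0 0"
    using leading[OF assms(1) subsetD[OF free_homog_upto assms(2)]] free_part_of_homog[OF assms(2)] by simp
  then show ?thesis
    using FK_ideal_lookup(3) by (simp add: FK_functional_def)
qed

lemma homog_2: "free_var x * free_var y \<in> free_homog 2"
  using free_homog_mult[OF free_homog_var free_homog_var, of x y] by (simp add: numeral_2_eq_2)

lemma lift_2E:
  assumes "p \<in> FK_ideal 0 0" "p \<in> free_homog 2"
  obtains k \<alpha> \<beta> \<gamma> where "p - (K k + K \<alpha> * a + K \<beta> * b + K \<gamma> * c) \<in> N"
proof -
  obtain q where "q \<in> free_below 2" "p - q \<in> N" using lift[OF assms] by blast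
  moreover have "free_below 2 = (free_upto 1 :: 'k free_alg set)"
    using free_below_Suc[of 1] by (simp add: numeral_2_eq_2)
  ultimately show thesis using free_upto_1E[of q] that by metis
qed

text \<open>The transposition (23) fixes a^2 and sends the linear part \<alpha> a + \<beta> b +
  \<gamma> c to - \<alpha> a - \<gamma> b - \<beta> c; comparison gives 2 \<alpha> = 0 and \<gamma>
  = - \<beta>. The transpositions (1 i) then transport the relation for a to all generators with one
  common constant.\<close>

lemma square_relation: "\<exists>k. \<forall>x. free_var x * free_var x - K k \<in> N"
proof -
  have "a * a \<in> FK_ideal 0 0"
    using D3_relators_in_FK_ideal[of 0 0] by (auto simp: D3_relators_def Let_def)
  then obtain k \<alpha> \<beta> \<gamma> where N: "a * a - (K k + K \<alpha> * a + K \<beta> * b + K \<gamma> * c) \<in> N"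
    using homog_2 by (rule lift_2E)
  have t23: "Transposition.transpose 2 3 permutes {1..3::nat}"
    by (rule permutes_swap_id) auto
  have "S3_act (Transposition.transpose 2 3) (a * a - (K k + K \<alpha> * a + K \<beta> * b + K \<gamma> * c)) \<in> N"
    by (rule act[OF t23 N])
  also have "S3_act (Transposition.transpose 2 3) (a * a - (K k + K \<alpha> * a + K \<beta> * b + K \<gamma> * c)) =
    a * a - (K k - K \<alpha> * a - K \<beta> * c - K \<gamma> * b)"
    by (simp add: S3_act_hom S3_act_23)
  finally have "a * a - (K k - K \<alpha> * a - K \<beta> * c - K \<gamma> * b) - (a * a - (K k + K \<alpha> * a + K \<beta> * b + K \<gamma> * c)) \<in> N"
    using N by (rule diff_N)
  then have "K 0 + (K \<alpha> + K \<alpha>) * a + (K \<beta> + K \<gamma>) * b + (K \<beta> + K \<gamma>) * c \<in> N"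
    by (simp add: algebra_simps)
  then have "K 0 + K (\<alpha> + \<alpha>) * a + K (\<beta> + \<gamma>) * b + K (\<beta> + \<gamma>) * c \<in> N"
    by (simp only: free_const_add)
  from coefficients_zero(2,3)[OF this] have "2 * \<alpha> = 0" "\<gamma> = - \<beta>"
    by (simp_all add: eq_neg_iff_add_eq_0 add.commute)
  with two have "\<alpha> = 0" by simp
  from N have N: "a * a - (K k + K \<beta> * b - K \<beta> * c) \<in> N"
    by (simp add: \<open>\<alpha> = 0\<close> \<open>\<gamma> = - \<beta>\<close> free_const_uminus)
  \<comment> \<open>\<open>a\<close> commutes with \<open>a\<^sup>2\<close>, hence with \<open>\<beta> (b - c)\<close>, which forces \<open>\<beta> = 0\<close>.\<close>
  have "(a * a - (K k + K \<beta> * b - K \<beta> * c)) * a - a * (a * a - (K k + K \<beta> * b - K \<beta> * c)) \<in> N"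
    by (rule diff_N[OF right_N[OF N] left_N[OF N]])
  also have "(a * a - (K k + K \<beta> * b - K \<beta> * c)) * a - a * (a * a - (K k + K \<beta> * b - K \<beta> * c)) =
    K \<beta> * (a * b - a * c - b * a + c * a)"
    using free_const_commute[of k a] free_const_commute[of \<beta> a]
    by (simp add: algebra_simps) (simp flip: mult.assoc)
  finally have "FK_functional (K \<beta> * (a * b - a * c - b * a + c * a)) = 0"
    by (rule functional_zero) (intro free_homog_const_mult free_homog_add free_homog_diff homog_2)
  \<comment> \<open>Of the four words the functional sees only \<open>a * b\<close>; its value is
    \<open>- \<beta>\<close>.\<close>
  then have "\<beta> = 0" by (simp add: FK_functional_simps)
  with N have aN: "a * a - K k \<in> N" by simp
  have "free_var x * free_var x - K k \<in> N" for x
  proof -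
    let ?t = "Transposition.transpose 1 (gen_index x)"
    have t: "?t permutes {1..3}"
      using gen_index_range[of x] by (intro permutes_swap_id) auto
    have "perm_gen ?t Gen_a = x" by (rule perm_gen_eqI) simp
    \<comment> \<open>Both signs occur, as \<open>?t\<close> is the identity for
      \<open>Gen_a\<close>; the sign is squared in the product of two generators.\<close>
    moreover have "sign ?t = 1 \<or> sign ?t = - 1" by (simp add: sign_def)
    ultimately have "S3_act ?t (a * a - K k) = free_var x * free_var x - K k"
      by (auto simp: S3_act_def free_hom_diff free_hom_mult)
    then show ?thesis using act[OF t aN] by simp
  qed
  then show ?thesis by blast
qed

text \<open>The 3-cycle (12)(23) permutes a, b, c cyclically without signs and fixes the first
  quadratic form, so the coefficients of its linear part agree. The transposition (23) exchanges the
  two forms and negates a + b + c, so lifting the first form alone yields both relations, with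
  opposite linear terms.\<close>

lemma triangle_relation:
  assumes square: "\<And>x. free_var x * free_var x - K k \<in> N"
  shows "\<exists>l. c * a + b * c + a * b - K l \<in> N \<and> c * b + b * a + a * c - K l \<in> N"
proof -
  let ?r = "c * a + b * c + a * b" and ?r' = "c * b + b * a + a * c"
  have "?r \<in> FK_ideal 0 0"
    using D3_relators_in_FK_ideal[of 0 0] by (auto simp: D3_relators_def Let_def)
  moreover have "?r \<in> free_homog 2" by (intro free_homog_add homog_2)
  ultimately obtain l \<alpha> \<beta> \<gamma> where N: "?r - (K l + K \<alpha> * a + K \<beta> * b + K \<gamma> * c) \<in> N"
    by (rule lift_2E)
  let ?s = "Transposition.transpose 1 2 :: nat \<Rightarrow> nat" and ?t = "Transposition.transpose 2 3 :: nat \<Rightarrow> nat"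
  have s: "?s permutes {1..3}" and t: "?t permutes {1..3}"
    by (rule permutes_swap_id; simp)+
  have "S3_act ?s (S3_act ?t (?r - (K l + K \<alpha> * a + K \<beta> * b + K \<gamma> * c))) \<in> N"
    by (intro act s t N)
  also have "S3_act ?s (S3_act ?t (?r - (K l + K \<alpha> * a + K \<beta> * b + K \<gamma> * c))) =
    ?r - (K l + K \<alpha> * b + K \<beta> * c + K \<gamma> * a)"
    by (simp add: S3_act_hom S3_act_12 S3_act_23 del: One_nat_def)
  finally have "?r - (K l + K \<alpha> * b + K \<beta> * c + K \<gamma> * a) - (?r - (K l + K \<alpha> * a + K \<beta> * b + K \<gamma> * c)) \<in> N"
    using N by (rule diff_N)
  also have "?r - (K l + K \<alpha> * b + K \<beta> * c + K \<gamma> * a) - (?r - (K l + K \<alpha> * a + K \<beta> * b + K \<gamma> * c)) =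
    K 0 + (K \<alpha> - K \<gamma>) * a + (K \<beta> - K \<alpha>) * b + (K \<gamma> - K \<beta>) * c"
    by (simp add: algebra_simps)
  also have "\<dots> = K 0 + K (\<alpha> - \<gamma>) * a + K (\<beta> - \<alpha>) * b + K (\<gamma> - \<beta>) * c"
    by (simp only: free_const_def single_diff)
  finally have "K 0 + K (\<alpha> - \<gamma>) * a + K (\<beta> - \<alpha>) * b + K (\<gamma> - \<beta>) * c \<in> N" .
  from coefficients_zero(2,3)[OF this] have "\<alpha> = \<gamma>" "\<beta> = \<alpha>" by simp_all
  with N have N: "?r - (K l + K \<alpha> * (a + b + c)) \<in> N"
    by (simp add: distrib_left add.assoc)
  have "S3_act ?t (?r - (K l + K \<alpha> * (a + b + c))) \<in> N"
    by (intro act t N)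
  also have "S3_act ?t (?r - (K l + K \<alpha> * (a + b + c))) = ?r' - (K l - K \<alpha> * (a + b + c))"
    by (simp add: S3_act_hom S3_act_23) (simp add: algebra_simps)
  finally have N': "?r' - (K l - K \<alpha> * (a + b + c)) \<in> N" .
  let ?q = "?r - (K l + K \<alpha> * (a + b + c))" and ?q' = "?r' - (K l - K \<alpha> * (a + b + c))"
  let ?A = "a * a - K k" and ?B = "b * b - K k"
  let ?S = "a + b + c"
  \<comment> \<open>The overlap \<open>r a - a r' - b r + r' b = c a\<^sup>2 - a\<^sup>2 c - b\<^sup>2 c + c b\<^sup>2\<close> of the relations turns the linear
    terms \<open>\<alpha> (a + b + c)\<close> into a quadratic element of \<open>N\<close>, which forces \<open>\<alpha> = 0\<close>.\<close>
  have "?q * a - a * ?q' - b * ?q + ?q' * b - (c * ?A - ?A * c - ?B * c + c * ?B) \<in> N"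
    by (rule diff_N[OF add_N[OF diff_N[OF diff_N[OF right_N[OF N] left_N[OF N']] left_N[OF N]] right_N[OF N']]
          add_N[OF diff_N[OF diff_N[OF left_N right_N] right_N] left_N]]) (rule square)+
  also have "?q * a - a * ?q' - b * ?q + ?q' * b - (c * ?A - ?A * c - ?B * c + c * ?B) =
    - (K \<alpha> * (?S * a + a * ?S - b * ?S - ?S * b))"
  proof -
    have 1: "(r - u) * a - a * (r' - v) - b * (r - u) + (r' - v) * b =
      (r * a - a * r' - b * r + r' * b) - (u * a - a * v - b * u + v * b)" for r r' u v
      by (simp add: algebra_simps)
    \<comment> \<open>The multipliers make the words \<open>bca\<close>, \<open>aba\<close>,
      \<open>acb\<close> and \<open>bab\<close> cancel in pairs; each remaining word contains a
      square and is covered by \<open>square\<close>.\<close>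
    have 2: "?r * a - a * ?r' - b * ?r + ?r' * b = c * (a * a) - (a * a) * c - (b * b) * c + c * (b * b)"
      by (simp add: algebra_simps)
    have 3: "c * (A - K k) - (A - K k) * c - (B - K k) * c + c * (B - K k) = c * A - A * c - B * c + c * B" for A B
      by (simp add: algebra_simps free_const_commute[of k c])
    have K: "a * (K \<alpha> * S) = K \<alpha> * (a * S)" "b * (K \<alpha> * S) = K \<alpha> * (b * S)" for S
      using free_const_commute[of \<alpha> a] free_const_commute[of \<alpha> b] by (simp_all flip: mult.assoc)
    \<comment> \<open>The opposite signs of the linear terms turn commutators into anticommutators,
      which therefore do not vanish, while the constant \<open>l\<close> cancels.\<close>
    have 4: "(K l + K \<alpha> * S) * a - a * (K l - K \<alpha> * S) - b * (K l + K \<alpha> * S) + (K l - K \<alpha> * S) * b =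
      K \<alpha> * (S * a + a * S - b * S - S * b)" for S
      by (simp add: algebra_simps K free_const_commute[of l a] free_const_commute[of l b])
    show ?thesis unfolding 1 2 3 4 by simp
  qed
  finally have "FK_functional (- (K \<alpha> * (?S * a + a * ?S - b * ?S - ?S * b))) = 0"
    by (rule functional_zero)
      (unfold distrib_left distrib_right, intro free_homog_uminus free_homog_const_mult free_homog_add free_homog_diff homog_2)
  \<comment> \<open>In the bracket \<open>bc\<close> has coefficient -1 and the two occurrences of
    \<open>ab\<close> cancel, so the functional returns \<alpha> itself.\<close>
  then have "\<alpha> = 0" by (simp only: distrib_left distrib_right FK_functional_simps) simp
  with N have "?r - K l \<in> N" by (simp only: free_const_0 mult_zero_left add_0_right)
  moreover from N' \<open>\<alpha> = 0\<close> have "?r' - K l \<in> N" by (simp only: free_const_0 mult_zero_left diff_zero)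
  ultimately show ?thesis by blast
qed

lemma ideal_eq: "\<exists>\<gamma>1 \<gamma>2. N = FK_ideal \<gamma>1 \<gamma>2"
proof -
  obtain k where k: "\<And>x. free_var x * free_var x - K k \<in> N" using square_relation by blast
  obtain l where l: "c * a + b * c + a * b - K l \<in> N" "c * b + b * a + a * c - K l \<in> N"
    using triangle_relation[OF k] by blast
  have "D3_relators k l \<subseteq> N"
    using k l by (auto simp: D3_relators_def Let_def)
  then have sub: "FK_ideal k l \<subseteq> N" by (rule FK_ideal_minimal[OF ideal])
  note J = FK_ideal_ideal[of k l]
  have "p \<in> FK_ideal k l" if "p \<in> N" "p \<in> free_below n" for p n
    using that
  proof (induction n arbitrary: p)
    case 0
    then show ?case using free_ideal_zero[OF J] by (simp add: free_below_0)
  next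
    case (Suc n)
    then have p: "p \<in> free_upto n" by (simp add: free_below_Suc)
    obtain q where q: "q \<in> free_below n" "free_part n (free_part n p) - q \<in> FK_ideal k l"
      using FK_ideal_part[OF leading[OF Suc.prems(1) p]] by blast
    have t: "free_part n p - q \<in> FK_ideal k l"
      using q(2) free_part_of_homog[OF free_part_homog] by metis
    \<comment> \<open>By \<open>sub\<close> the correction lies in \<open>N\<close> as well, so the
      remainder satisfies the same hypotheses one degree lower.\<close>
    have "p - (free_part n p - q) \<in> N"
      using Suc.prems(1) subsetD[OF sub t] by (rule diff_N)
    moreover have "(p - free_part n p) + q \<in> free_below n"
      by (intro free_below_add free_part_below p q(1))
    ultimately have "p - (free_part n p - q) \<in> FK_ideal k l"
      by (intro Suc.IH) (simp_all add: algebra_simps)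
    from free_ideal_add[OF J this t] show ?case by simp
  qed
  moreover have "\<exists>n. p \<in> free_below n" for p :: "'k free_alg"
    using free_upto_exhaustive free_below_Suc by blast
  ultimately have "N \<subseteq> FK_ideal k l" by blast
  with sub show ?thesis by blast
qed

end


section \<open>Quotients of the free algebra\<close>

definition free_coset :: "'k::field free_alg set \<Rightarrow> 'k free_alg \<Rightarrow> 'k free_alg set"
  where "free_coset J p = {x. x - p \<in> J}"

lemma a_r_coset_free: "J +>\<^bsub>free_filtered\<^esub> p = free_coset J p"
proof -
  have "\<exists>h\<in>J. x = h + p" if "x - p \<in> J" for x
    using that by (intro bexI[of _ "x - p"]) simp_all
  then show ?thesis by (auto simp: a_r_coset_def' free_filtered_simps free_coset_def)
qed

lemma a_r_coset_free_graded: "J +>\<^bsub>free_graded\<^esub> p = free_coset J p"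
  unfolding a_r_coset_free[symmetric] by (simp add: a_r_coset_def' free_graded_def free_filtered_def)

lemma a_rcosets_free: "a_rcosets\<^bsub>free_filtered\<^esub> J = range (free_coset J)"
  unfolding A_RCOSETS_def' a_r_coset_free free_filtered_simps by blast

lemma a_rcosets_free_graded: "a_rcosets\<^bsub>free_graded\<^esub> J = range (free_coset J)"
proof -
  have "carrier free_graded = UNIV" by (simp add: free_graded_def free_filtered_def)
  then show ?thesis unfolding A_RCOSETS_def' a_r_coset_free_graded by blast
qed

lemma free_coset_eq_iff:
  assumes "free_ideal J"
  shows "free_coset J p = free_coset J q \<longleftrightarrow> p - q \<in> J"
proof
  assume "free_coset J p = free_coset J q"
  moreover have "p \<in> free_coset J p" using free_ideal_zero[OF assms] by (simp add: free_coset_def)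
  ultimately show "p - q \<in> J" by (simp add: free_coset_def)
next
  assume pq: "p - q \<in> J"
  have "x - p \<in> J \<longleftrightarrow> x - q \<in> J" for x
    using free_ideal_add[OF assms _ pq, of "x - p"] free_ideal_diff[OF assms _ pq, of "x - q"] by auto
  then show "free_coset J p = free_coset J q" by (simp add: free_coset_def)
qed

text \<open>Only the pieces differ, so the operations of \<open>E3\<close> can be read off from the
  filtered quotient.\<close>

lemma quotient_free_graded:
  "quotient_alg free_graded J = quotient_alg free_filtered J \<lparr>piece := \<lambda>n. free_coset J ` free_homog n\<rparr>"
proof -
  let ?A = "free_filtered :: (nat \<Rightarrow> nat, 'a, 'a free_alg) module_alg"
    and ?B = "free_graded :: (nat \<Rightarrow> nat, 'a, 'a free_alg) module_alg"
  have fields: "monoid.mult ?B = monoid.mult ?A" "one ?B = one ?A" "add ?B = add ?A"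
    "module.smult ?B = module.smult ?A" "act ?B = act ?A" "piece ?B = free_homog"
    by (simp_all add: free_graded_def free_filtered_def free_homog_def fun_eq_iff)
  have "coset_map ?B J = coset_map ?A J" "rcoset_mult ?B J = rcoset_mult ?A J"
    by (intro ext; simp add: coset_map_def rcoset_mult_def a_r_coset_free a_r_coset_free_graded fields)+
  moreover have "set_add ?B = set_add ?A"
    by (intro ext) (simp add: set_add_defs fields)
  ultimately show ?thesis
    by (simp add: quotient_alg_def FactRing_def a_r_coset_free a_r_coset_free_graded a_rcosets_free
        a_rcosets_free_graded fields)
qed

text \<open>The rule for the action assumes that the ideal is stable under it, since otherwise
  \<open>coset_map\<close> could unite several cosets; stability under scalars is automatic, as
  these act by multiplication with constants.\<close>

lemma quotient_free_simps:
  assumes J: "free_ideal J"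
  defines "Q \<equiv> quotient_alg free_filtered J"
  shows "carrier Q = range (free_coset J)"
    and "free_coset J p \<otimes>\<^bsub>Q\<^esub> free_coset J q = free_coset J (p * q)"
    and "free_coset J p \<oplus>\<^bsub>Q\<^esub> free_coset J q = free_coset J (p + q)"
    and "\<one>\<^bsub>Q\<^esub> = free_coset J 1"
    and "\<zero>\<^bsub>Q\<^esub> = free_coset J 0"
    and "k \<odot>\<^bsub>Q\<^esub> free_coset J p = free_coset J (free_const k * p)"
    and "(\<And>p. p \<in> J \<Longrightarrow> S3_act \<sigma> p \<in> J) \<Longrightarrow> act Q \<sigma> (free_coset J p) = free_coset J (S3_act \<sigma> p)"
    and "piece Q n = free_coset J ` free_upto n"
proof -
  interpret ideal J "free_filtered :: (nat \<Rightarrow> nat, 'a, 'a free_alg) module_alg"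
    using J by (simp add: ideal_free_filtered)
  note coset = a_r_coset_free[symmetric]
  show "carrier Q = range (free_coset J)"
    by (simp add: Q_def quotient_alg_simps FactRing_def a_rcosets_free)
  show "free_coset J p \<otimes>\<^bsub>Q\<^esub> free_coset J q = free_coset J (p * q)"
    by (simp add: Q_def quotient_alg_simps FactRing_def coset rcoset_mult_add free_filtered_simps)
  show "free_coset J p \<oplus>\<^bsub>Q\<^esub> free_coset J q = free_coset J (p + q)"
    by (simp add: Q_def quotient_alg_simps FactRing_def coset a_rcos_sum free_filtered_simps)
  show "\<one>\<^bsub>Q\<^esub> = free_coset J 1"
    by (simp add: Q_def quotient_alg_simps FactRing_def coset free_filtered_simps)
  show "\<zero>\<^bsub>Q\<^esub> = free_coset J 0"
    by (simp add: Q_def quotient_alg_simps FactRing_def free_coset_def)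
  show "k \<odot>\<^bsub>Q\<^esub> free_coset J p = free_coset J (free_const k * p)"
    unfolding Q_def quotient_alg_simps coset
    by (subst coset_map_coset) (simp_all add: free_filtered_simps distrib_left free_ideal_mult_left[OF J])
  show "act Q \<sigma> (free_coset J p) = free_coset J (S3_act \<sigma> p)" if "\<And>p. p \<in> J \<Longrightarrow> S3_act \<sigma> p \<in> J"
    unfolding Q_def quotient_alg_simps coset
    by (subst coset_map_coset) (simp_all add: free_filtered_simps S3_act_hom that)
  show "piece Q n = free_coset J ` free_upto n"
    by (simp add: Q_def quotient_alg_simps free_filtered_simps a_r_coset_free)
qed

text \<open>The preimage of the ideal under an algebra endomorphism is an ideal, and it contains the
  relators because the group maps relators to relators.\<close>

lemma FK_ideal_S3_act:
  assumes "\<sigma> permutes {1..3}" "p \<in> FK_ideal \<gamma>1 (\<gamma>2 :: 'k::field)"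
  shows "S3_act \<sigma> p \<in> FK_ideal \<gamma>1 \<gamma>2"
proof -
  let ?S = "{p. S3_act \<sigma> p \<in> FK_ideal \<gamma>1 \<gamma>2}"
  note J = FK_ideal_ideal[of \<gamma>1 \<gamma>2]
  have "S3_act \<sigma> 0 = (0 :: 'k free_alg)" by (simp add: S3_act_def)
  then have "free_ideal ?S"
    by (intro free_idealI)
      (auto simp: S3_act_hom free_ideal_zero[OF J] intro: free_ideal_add[OF J] free_ideal_mult_left[OF J]
        free_ideal_mult_right[OF J])
  moreover have "D3_relators \<gamma>1 \<gamma>2 \<subseteq> ?S"
    using D3_relators_act[OF assms(1)] D3_relators_in_FK_ideal by blast
  ultimately show ?thesis using FK_ideal_minimal assms(2) by blast
qed

lemma D3_eq: "D3 \<gamma>1 \<gamma>2 = quotient_alg free_filtered (FK_ideal \<gamma>1 \<gamma>2)"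
  by (simp add: D3_def FK_ideal_def)

lemma E3_eq: "E3 = quotient_alg free_filtered (FK_ideal 0 0)
  \<lparr>piece := \<lambda>n. free_coset (FK_ideal 0 0) ` free_homog n\<rparr>"
  by (simp add: E3_def genideal_free_graded quotient_free_graded)

section \<open>Symbols in the associated graded algebra\<close>

text \<open>Counterpart of \<open>coset_map_coset\<close> for additive subgroups: the steps of a
  filtration are in general not ideals.\<close>

lemma (in abelian_subgroup) coset_map_additive:
  assumes "x \<in> carrier G" "\<And>y. y \<in> carrier G \<Longrightarrow> f y \<in> carrier G"
    and "\<And>y z. \<lbrakk>y \<in> carrier G; z \<in> carrier G\<rbrakk> \<Longrightarrow> f (y \<oplus> z) = f y \<oplus> f z"
    and "\<And>y. y \<in> H \<Longrightarrow> f y \<in> H"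
  shows "coset_map G H f (H +> x) = H +> f x"
proof -
  have "H +> f y = H +> f x" if "y \<in> H +> x" for y
  proof -
    from that obtain h where h: "h \<in> H" "y = h \<oplus> x" by (auto simp: a_r_coset_def')
    then have "f y = f h \<oplus> f x" using assms(1,3) a_subset by blast
    with h(1) assms(4) have "f y \<in> H +> f x" by (auto simp: a_r_coset_def')
    then show ?thesis using a_repr_independence' assms(1,2) by metis
  qed
  moreover have "x \<in> H +> x" using assms(1) by (rule a_rcos_self)
  ultimately show ?thesis unfolding coset_map_def by blast
qed

text \<open>The principal symbol. The degree \<open>n\<close> is an argument because
  \<open>d\<close> may already lie in a smaller step; its symbol in degree \<open>n\<close> is then
  zero.\<close>

definition symbol :: "('g, 'k, 'a) module_alg \<Rightarrow> nat \<Rightarrow> 'a \<Rightarrow> nat \<Rightarrow> 'a set"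
  where "symbol D n d = (lower D)(n := lower D n +>\<^bsub>D\<^esub> d)"

lemma gr_simps:
  "carrier (gr D) = {f. (\<forall>n. f n \<in> gr_component D n) \<and> finite {n. f n \<noteq> lower D n}}"
  "monoid.mult (gr D) f g = (\<lambda>n. \<Union>{lower D n +>\<^bsub>D\<^esub> (\<Oplus>\<^bsub>D\<^esub>i\<in>{..n}. x i \<otimes>\<^bsub>D\<^esub> y (n - i)) | x y.
       (\<forall>i. x i \<in> f i) \<and> (\<forall>j. y j \<in> g j)})"
  "one (gr D) = (lower D)(0 := lower D 0 +>\<^bsub>D\<^esub> \<one>\<^bsub>D\<^esub>)"
  "ring.zero (gr D) = lower D"
  "ring.add (gr D) f g = (\<lambda>n. f n <+>\<^bsub>D\<^esub> g n)"
  "module.smult (gr D) k f = (\<lambda>n. coset_map D (lower D n) (\<lambda>x. k \<odot>\<^bsub>D\<^esub> x) (f n))"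
  "act (gr D) \<sigma> f = (\<lambda>n. coset_map D (lower D n) (act D \<sigma>) (f n))"
  "piece (gr D) n = {f \<in> carrier (gr D). \<forall>m. m \<noteq> n \<longrightarrow> f m = lower D m}"
  by (simp_all add: gr_def Let_def)

context filtered_module_algebra
begin

lemma piece_carrier: "x \<in> piece A n \<Longrightarrow> x \<in> carrier A"
  using piece_exhaustive by blast

end

text \<open>Specialises the record scheme to \<open>module_alg\<close> without extension, the type
  on which \<open>lower\<close> and \<open>gr\<close> are defined.\<close>

locale filtered_alg = filtered_module_algebra G K D
  for G :: "('g, 'n) monoid_scheme" and K :: "('k, 'l) ring_scheme" and D :: "('g, 'k, 'd) module_alg"
begin

lemma piece_zero: "\<zero>\<^bsub>D\<^esub> \<in> piece D n"
  using subgroup.one_closed[OF submodule.axioms(1)[OF piece_submodule[of n]]] by simp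

lemma lower_submodule: "submodule (lower D n) K D"
proof (cases n)
  case 0
  have "submodule {\<zero>\<^bsub>D\<^esub>} K D"
    by (rule submoduleI) auto
  then show ?thesis by (simp add: 0 lower_def)
next
  case (Suc m)
  then show ?thesis using piece_submodule by (simp add: lower_def)
qed

lemma lower_piece: "lower D n \<subseteq> piece D n"
  using piece_zero piece_mono by (auto simp: lower_def split: nat.splits)

lemma lower_carrier: "x \<in> lower D n \<Longrightarrow> x \<in> carrier D"
  using lower_piece piece_carrier by blast

lemma lower_abelian_subgroup: "abelian_subgroup (lower D n) D"
  using submodule.axioms(1)[OF lower_submodule[of n]]
  by (intro abelian_subgroupI3 additive_subgroup.intro is_abelian_group)

lemma lower_act: "\<lbrakk>g \<in> carrier G; x \<in> lower D n\<rbrakk> \<Longrightarrow> act D g x \<in> lower D n"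
proof (cases n)
  case 0
  assume g: "g \<in> carrier G" and x: "x \<in> lower D n"
  have "act D g (\<zero>\<^bsub>D\<^esub> \<oplus>\<^bsub>D\<^esub> \<zero>\<^bsub>D\<^esub>) = act D g \<zero>\<^bsub>D\<^esub> \<oplus>\<^bsub>D\<^esub> act D g \<zero>\<^bsub>D\<^esub>"
    using g by (intro act_add) auto
  then have "act D g \<zero>\<^bsub>D\<^esub> = \<zero>\<^bsub>D\<^esub>"
    using act_closed[OF g zero_closed] by (simp add: add.l_cancel_one')
  then show ?thesis using x 0 by (simp add: lower_def)
qed (simp add: lower_def piece_act)

lemma lower_mult_left: "\<lbrakk>x \<in> lower D m; y \<in> piece D n\<rbrakk> \<Longrightarrow> x \<otimes>\<^bsub>D\<^esub> y \<in> lower D (m + n)"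
  using piece_mult piece_carrier subsetD[OF lower_piece]
  by (cases m) (auto simp: lower_def submodule.axioms piece_zero split: nat.splits)

lemma lower_mult_right: "\<lbrakk>x \<in> piece D m; y \<in> lower D n\<rbrakk> \<Longrightarrow> x \<otimes>\<^bsub>D\<^esub> y \<in> lower D (m + n)"
  using piece_mult piece_carrier
  by (cases n) (auto simp: lower_def piece_zero split: nat.splits)

lemma lower_smult: "\<lbrakk>k \<in> carrier K; x \<in> lower D n\<rbrakk> \<Longrightarrow> k \<odot>\<^bsub>D\<^esub> x \<in> lower D n"
  using submoduleE(4)[OF lower_submodule] .

lemma lower_add: "\<lbrakk>x \<in> lower D n; y \<in> lower D n\<rbrakk> \<Longrightarrow> x \<oplus>\<^bsub>D\<^esub> y \<in> lower D n"
  using submoduleE(5)[OF lower_submodule] .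

lemma lower_zero: "\<zero>\<^bsub>D\<^esub> \<in> lower D n"
  using abelian_subgroup.axioms(1)[OF lower_abelian_subgroup] additive_subgroup.zero_closed by blast

lemma lower_coset_zero: "lower D n +>\<^bsub>D\<^esub> \<zero>\<^bsub>D\<^esub> = lower D n"
  by (rule a_coset_add_zero) (use lower_carrier in blast)

lemma lower_coset_eq_iff:
  "\<lbrakk>x \<in> carrier D; y \<in> carrier D\<rbrakk> \<Longrightarrow> lower D n +>\<^bsub>D\<^esub> x = lower D n +>\<^bsub>D\<^esub> y \<longleftrightarrow> x \<ominus>\<^bsub>D\<^esub> y \<in> lower D n"
  using abelian_subgroup.a_rcos_module[OF lower_abelian_subgroup, of y x n]
    abelian_subgroup.a_repr_independence'[OF lower_abelian_subgroup, of x n y]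
    abelian_subgroup.a_rcos_self[OF lower_abelian_subgroup, of x n]
  by (metis a_minus_def)

lemma lower_coset_eq_lower_iff: "x \<in> carrier D \<Longrightarrow> lower D n +>\<^bsub>D\<^esub> x = lower D n \<longleftrightarrow> x \<in> lower D n"
  using lower_coset_eq_iff[of x "\<zero>\<^bsub>D\<^esub>" n] by (simp add: lower_coset_zero a_minus_def)

text \<open>Writes the zero components as cosets too, so that coset lemmas apply uniformly in all
  degrees.\<close>

lemma symbol_alt: "symbol D n d m = lower D m +>\<^bsub>D\<^esub> (if m = n then d else \<zero>\<^bsub>D\<^esub>)"
  by (simp add: symbol_def lower_coset_zero)

lemma symbol_piece:
  assumes "d \<in> piece D n"
  shows "symbol D n d \<in> piece (gr D) n"
proof -
  have "finite {m. symbol D n d m \<noteq> lower D m}"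
    by (rule finite_subset[of _ "{n}"]) (auto simp: symbol_def)
  moreover have "symbol D n d m \<in> gr_component D m" for m
    unfolding gr_component_def symbol_alt using assms piece_zero by auto
  ultimately show ?thesis by (auto simp: gr_simps symbol_def)
qed

text \<open>Homogeneous elements of \<open>gr D\<close> are symbols, so the operations of
  \<open>gr D\<close> have to be evaluated on symbols only.\<close>

lemma gr_pieceE:
  assumes "f \<in> piece (gr D) n"
  obtains d where "d \<in> piece D n" "f = symbol D n d"
proof -
  from assms have "f n \<in> gr_component D n" by (auto simp: gr_simps)
  then obtain d where d: "d \<in> piece D n" "f n = lower D n +>\<^bsub>D\<^esub> d"
    unfolding gr_component_def by blast
  with assms have "f = symbol D n d" by (auto simp: symbol_def gr_simps fun_eq_iff)
  with d(1) show thesis by (rule that)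
qed

lemma symbol_zero_iff: "d \<in> carrier D \<Longrightarrow> symbol D n d = \<zero>\<^bsub>gr D\<^esub> \<longleftrightarrow> d \<in> lower D n"
  by (auto simp: gr_simps symbol_def fun_eq_iff lower_coset_eq_lower_iff split: if_splits)

lemma symbol_one: "symbol D 0 \<one>\<^bsub>D\<^esub> = \<one>\<^bsub>gr D\<^esub>"
  by (simp add: symbol_def gr_simps)

lemma symbol_add:
  assumes "d \<in> carrier D" "e \<in> carrier D"
  shows "symbol D n d \<oplus>\<^bsub>gr D\<^esub> symbol D n e = symbol D n (d \<oplus>\<^bsub>D\<^esub> e)"
  using assms by (auto simp: gr_simps symbol_alt fun_eq_iff abelian_subgroup.a_rcos_sum[OF lower_abelian_subgroup])

lemma symbol_smult:
  assumes "k \<in> carrier K" "d \<in> carrier D"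
  shows "k \<odot>\<^bsub>gr D\<^esub> symbol D n d = symbol D n (k \<odot>\<^bsub>D\<^esub> d)"
proof -
  have "coset_map D (lower D m) (\<lambda>x. k \<odot>\<^bsub>D\<^esub> x) (lower D m +>\<^bsub>D\<^esub> x) = lower D m +>\<^bsub>D\<^esub> (k \<odot>\<^bsub>D\<^esub> x)"
    if "x \<in> carrier D" for m x
    using assms that
    by (intro abelian_subgroup.coset_map_additive[OF lower_abelian_subgroup]) (auto simp: smult_r_distr lower_smult)
  then show ?thesis using assms by (auto simp: gr_simps symbol_alt fun_eq_iff)
qed

lemma act_zero: "g \<in> carrier G \<Longrightarrow> act D g \<zero>\<^bsub>D\<^esub> = \<zero>\<^bsub>D\<^esub>"
  using lower_act[of g "\<zero>\<^bsub>D\<^esub>" 0] by (simp add: lower_def)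

lemma symbol_act:
  assumes "g \<in> carrier G" "d \<in> carrier D"
  shows "act (gr D) g (symbol D n d) = symbol D n (act D g d)"
proof -
  have "coset_map D (lower D m) (act D g) (lower D m +>\<^bsub>D\<^esub> x) = lower D m +>\<^bsub>D\<^esub> (act D g x)"
    if "x \<in> carrier D" for m x
    using assms that
    by (intro abelian_subgroup.coset_map_additive[OF lower_abelian_subgroup]) (auto simp: act_closed act_add lower_act)
  then show ?thesis using assms by (auto simp: gr_simps symbol_alt fun_eq_iff act_zero)
qed

lemma lower_finsum: "\<lbrakk>finite I; \<And>i. i \<in> I \<Longrightarrow> f i \<in> lower D n\<rbrakk> \<Longrightarrow> finsum D f I \<in> lower D n"
proof (induction I rule: finite_induct)
  case empty
  then show ?case by (simp add: lower_zero)
next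
  case (insert i I)
  then have "f \<in> I \<rightarrow> carrier D" "f i \<in> carrier D" using lower_carrier by blast+
  with insert show ?case by (simp add: finsum_insert lower_add)
qed

lemma lower_cosetD:
  assumes "x \<in> lower D n +>\<^bsub>D\<^esub> d" "d \<in> piece D n"
  shows "x \<in> piece D n" "x \<ominus>\<^bsub>D\<^esub> d \<in> lower D n"
proof -
  from assms(1) obtain l where l: "l \<in> lower D n" "x = l \<oplus>\<^bsub>D\<^esub> d" by (auto simp: a_r_coset_def')
  then show "x \<in> piece D n"
    using submoduleE(5)[OF piece_submodule] lower_piece assms(2) by blast
  have "l \<in> carrier D" "d \<in> carrier D" using l(1) assms(2) lower_carrier piece_carrier by auto
  then have "l \<oplus>\<^bsub>D\<^esub> d \<ominus>\<^bsub>D\<^esub> d = l" by algebra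
  with l show "x \<ominus>\<^bsub>D\<^esub> d \<in> lower D n" by simp
qed

text \<open>The product in \<open>gr D\<close> is a union over all choices of representatives. The
  point is that every choice gives the same coset: replacing the representatives by
  \<open>d\<close>, \<open>e\<close> and zeros changes the sum of products by an element of
  \<open>lower D k\<close>.\<close>

lemma symbol_mult:
  assumes d: "d \<in> piece D m" and e: "e \<in> piece D n"
  shows "symbol D m d \<otimes>\<^bsub>gr D\<^esub> symbol D n e = symbol D (m + n) (d \<otimes>\<^bsub>D\<^esub> e)"
proof
  fix k
  let ?d = "\<lambda>i. if i = m then d else \<zero>\<^bsub>D\<^esub>" and ?e = "\<lambda>j. if j = n then e else \<zero>\<^bsub>D\<^esub>"
  let ?de = "if k = m + n then d \<otimes>\<^bsub>D\<^esub> e else \<zero>\<^bsub>D\<^esub>"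
  have carr: "d \<in> carrier D" "e \<in> carrier D" using d e piece_carrier by auto
  have dp: "?d i \<in> piece D i" and ep: "?e i \<in> piece D i" for i
    using d e piece_zero by auto
  have *: "lower D k +>\<^bsub>D\<^esub> (\<Oplus>\<^bsub>D\<^esub>i\<in>{..k}. x i \<otimes>\<^bsub>D\<^esub> y (k - i)) = lower D k +>\<^bsub>D\<^esub> ?de"
    if x: "\<And>i. x i \<in> symbol D m d i" and y: "\<And>j. y j \<in> symbol D n e j" for x y
  proof -
    have xp: "x i \<in> piece D i" "x i \<ominus>\<^bsub>D\<^esub> ?d i \<in> lower D i" for i
      using lower_cosetD[OF x[of i, unfolded symbol_alt] dp] by auto
    have yp: "y i \<in> piece D i" "y i \<ominus>\<^bsub>D\<^esub> ?e i \<in> lower D i" for i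
      using lower_cosetD[OF y[of i, unfolded symbol_alt] ep] by auto
    have xyc: "x i \<in> carrier D" "y i \<in> carrier D" for i using xp(1) yp(1) piece_carrier by auto
    have dec: "?d i \<in> carrier D" "?e i \<in> carrier D" for i using dp ep piece_carrier by blast+
    define z where "z = (\<lambda>i. x i \<otimes>\<^bsub>D\<^esub> y (k - i) \<ominus>\<^bsub>D\<^esub> ?d i \<otimes>\<^bsub>D\<^esub> ?e (k - i))"
    have z: "z i \<in> lower D k" if "i \<le> k" for i
    proof -
      \<comment> \<open>Telescoping x y - d e = (x - d) y + d (y - e): each summand has one factor
        of smaller degree.\<close>
      have "z i = (x i \<ominus>\<^bsub>D\<^esub> ?d i) \<otimes>\<^bsub>D\<^esub> y (k - i) \<oplus>\<^bsub>D\<^esub> ?d i \<otimes>\<^bsub>D\<^esub> (y (k - i) \<ominus>\<^bsub>D\<^esub> ?e (k - i))"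
        unfolding z_def using xyc[of i] xyc[of "k - i"] dec[of i] dec[of "k - i"] by algebra
      moreover have "(x i \<ominus>\<^bsub>D\<^esub> ?d i) \<otimes>\<^bsub>D\<^esub> y (k - i) \<in> lower D (i + (k - i))"
        by (rule lower_mult_left[OF xp(2) yp(1)])
      moreover have "?d i \<otimes>\<^bsub>D\<^esub> (y (k - i) \<ominus>\<^bsub>D\<^esub> ?e (k - i)) \<in> lower D (i + (k - i))"
        by (rule lower_mult_right[OF dp yp(2)])
      ultimately show ?thesis using that lower_add by simp
    qed
    have zc: "z i \<in> carrier D" for i
      unfolding z_def by (intro minus_closed m_closed xyc dec)
    have "(\<Oplus>\<^bsub>D\<^esub>i\<in>{..k}. x i \<otimes>\<^bsub>D\<^esub> y (k - i)) = (\<Oplus>\<^bsub>D\<^esub>i\<in>{..k}. z i \<oplus>\<^bsub>D\<^esub> ?d i \<otimes>\<^bsub>D\<^esub> ?e (k - i))"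
    proof (rule add.finprod_cong')
      show "x i \<otimes>\<^bsub>D\<^esub> y (k - i) = z i \<oplus>\<^bsub>D\<^esub> ?d i \<otimes>\<^bsub>D\<^esub> ?e (k - i)" for i
        unfolding z_def using xyc[of i] xyc[of "k - i"] dec[of i] dec[of "k - i"] by algebra
    qed (use zc carr in auto)
    also have "\<dots> = (\<Oplus>\<^bsub>D\<^esub>i\<in>{..k}. z i) \<oplus>\<^bsub>D\<^esub> (\<Oplus>\<^bsub>D\<^esub>i\<in>{..k}. ?d i \<otimes>\<^bsub>D\<^esub> ?e (k - i))"
      by (rule add.finprod_multf) (use zc carr in auto)
    \<comment> \<open>Both factors can be nonzero only for i = m and k - i = n, that is, for k = m +
      n.\<close>
    also have "(\<Oplus>\<^bsub>D\<^esub>i\<in>{..k}. ?d i \<otimes>\<^bsub>D\<^esub> ?e (k - i)) = (\<Oplus>\<^bsub>D\<^esub>i\<in>{..k}. if m = i then ?de else \<zero>\<^bsub>D\<^esub>)"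
      by (rule add.finprod_cong') (use carr in auto)
    also have "\<dots> = ?de"
    proof (cases "m \<le> k")
      case True
      then show ?thesis using add.finprod_singleton[of m "{..k}" "\<lambda>_. ?de"] carr by simp
    next
      case False
      then have "(\<Oplus>\<^bsub>D\<^esub>i\<in>{..k}. if m = i then ?de else \<zero>\<^bsub>D\<^esub>) = (\<Oplus>\<^bsub>D\<^esub>i\<in>{..k}. \<zero>\<^bsub>D\<^esub>)"
        by (intro add.finprod_cong') auto
      with False show ?thesis by simp
    qed
    finally have "(\<Oplus>\<^bsub>D\<^esub>i\<in>{..k}. x i \<otimes>\<^bsub>D\<^esub> y (k - i)) = (\<Oplus>\<^bsub>D\<^esub>i\<in>{..k}. z i) \<oplus>\<^bsub>D\<^esub> ?de" .
    moreover have "(\<Oplus>\<^bsub>D\<^esub>i\<in>{..k}. z i) \<in> lower D k" using z by (intro lower_finsum) auto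
    ultimately have "(\<Oplus>\<^bsub>D\<^esub>i\<in>{..k}. x i \<otimes>\<^bsub>D\<^esub> y (k - i)) \<in> lower D k +>\<^bsub>D\<^esub> ?de"
      by (auto simp: a_r_coset_def')
    then show ?thesis
      using abelian_subgroup.a_repr_independence'[OF lower_abelian_subgroup] carr by auto
  qed
  \<comment> \<open>At least one choice of representatives must exist, as the union over an empty
    family would be the empty set.\<close>
  have mem: "?d i \<in> symbol D m d i" "?e i \<in> symbol D n e i" for i
    unfolding symbol_alt using dp ep piece_carrier
    by (blast intro: abelian_subgroup.a_rcos_self[OF lower_abelian_subgroup])+
  have "{lower D k +>\<^bsub>D\<^esub> (\<Oplus>\<^bsub>D\<^esub>i\<in>{..k}. x i \<otimes>\<^bsub>D\<^esub> y (k - i)) | x y.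
       (\<forall>i. x i \<in> symbol D m d i) \<and> (\<forall>j. y j \<in> symbol D n e j)} = {lower D k +>\<^bsub>D\<^esub> ?de}" (is "?L = _")
  proof (rule equalityI)
    show "?L \<subseteq> {lower D k +>\<^bsub>D\<^esub> ?de}" using * by blast
    have "lower D k +>\<^bsub>D\<^esub> (\<Oplus>\<^bsub>D\<^esub>i\<in>{..k}. ?d i \<otimes>\<^bsub>D\<^esub> ?e (k - i)) \<in> ?L"
      using mem by (intro CollectI exI[of _ ?d] exI[of _ ?e]) auto
    then show "{lower D k +>\<^bsub>D\<^esub> ?de} \<subseteq> ?L" using *[OF mem] by simp
  qed
  then show "(symbol D m d \<otimes>\<^bsub>gr D\<^esub> symbol D n e) k = symbol D (m + n) (d \<otimes>\<^bsub>D\<^esub> e) k"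
    by (simp add: gr_simps symbol_alt)
qed

end


section \<open>Lifting the generators and evaluation\<close>

lemma free_alg_induct [case_names const var add mult]:
  assumes const: "\<And>k. P (free_const k)" and var: "\<And>x. P (free_var x)"
    and add: "\<And>p q. P p \<Longrightarrow> P q \<Longrightarrow> P (p + q)" and mult: "\<And>p q. P p \<Longrightarrow> P q \<Longrightarrow> P (p * q)"
  shows "P (p :: 'k::field free_alg)"
proof (induction p rule: free_induct)
  case (single w k)
  have "P (prod_list (map free_var xs))" for xs
    using const[of 1] by (induction xs) (simp_all add: var mult)
  then show ?case unfolding single_eq by (intro mult const)
qed (rule add)

text \<open>The action sends a generator to a signed generator and hence commutes with taking
  homogeneous parts. Stating it for the parts of an arbitrary element makes it additive and amenable
  to induction.\<close>

lemma free_homog_S3_act: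
  fixes p :: "'k::field free_alg"
  assumes "p \<in> free_homog n"
  shows "S3_act u p \<in> free_homog n"
proof -
  have "free_part n (S3_act u q) = S3_act u (free_part n q)" for q :: "'k free_alg"
  proof (induction q rule: free_induct)
    case (single w k)
    have s: "sign u = 1 \<or> sign u = - 1" by (simp add: sign_def)
    have "prod_list (map (\<lambda>x. of_int (sign u) * free_var (perm_gen u x)) xs) \<in> (free_homog (length xs) :: 'k free_alg set)" for xs
    proof (induction xs)
      case Nil
      then show ?case using free_homog_const[of 1] by simp
    next
      case (Cons x xs)
      have "of_int (sign u) * free_var (perm_gen u x) \<in> (free_homog 1 :: 'k free_alg set)"
        using s by (auto simp: free_homog_uminus free_homog_var simp del: One_nat_def)
      from free_homog_mult[OF this Cons] show ?case by simp
    qed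
    then have hw: "S3_act u (Poly_Mapping.single w k) \<in> free_homog (length (letters w))"
      unfolding S3_act_def free_hom_single by (rule free_homog_const_mult)
    have "S3_act u 0 = (0 :: 'k free_alg)" by (simp add: S3_act_def)
    then show ?case
      using free_part_of_homog[OF hw] free_part_of_homog_neq[OF hw, of n]
      by (cases "length (letters w) = n") (simp_all only: free_part_single if_True if_False simp_thms)
  next
    case (sum p q)
    then show ?case by (simp add: free_part_add S3_act_hom)
  qed
  from this[of p] have "free_part n (S3_act u p) = S3_act u p"
    by (simp only: free_part_of_homog[OF assms])
  with free_part_homog[of n "S3_act u p"] show ?thesis by (simp only:)
qed

lemma scalar_simps:
  "carrier ring_of_type_algebra = UNIV" "x \<otimes>\<^bsub>ring_of_type_algebra\<^esub> y = x * y"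
  "x \<oplus>\<^bsub>ring_of_type_algebra\<^esub> y = x + y" "\<one>\<^bsub>ring_of_type_algebra\<^esub> = 1" "\<zero>\<^bsub>ring_of_type_algebra\<^esub> = 0"
  by (simp_all add: ring_of_type_algebra_def)

section \<open>Comparison of D with \<open>E3\<close> through symbols\<close>

locale FK_graded = filtered_alg "sym_group 3" "ring_of_type_algebra :: 'k::field ring" D
  for D :: "(nat \<Rightarrow> nat, 'k::field, 'd) module_alg" +
  fixes \<psi> :: "(nat \<Rightarrow> 'd set) \<Rightarrow> 'k free_alg set"
  assumes iso: "\<psi> \<in> module_alg_iso (sym_group 3) (ring_of_type_algebra :: 'k ring) (gr D) E3"
    and two: "(2 :: 'k) \<noteq> 0"
begin

abbreviation "I0 \<equiv> FK_ideal 0 0 :: 'k free_alg set"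

text \<open>The scalars fill their type, so the premises on them are discharged once. Position 4 is
  associativity of scalars, 8 and 9 move a scalar out of the left and right factor, 10 commutes it
  with the action.\<close>

lemmas smult_simps = smult_closed[unfolded scalar_simps, OF UNIV_I]
  smult_l_distr[unfolded scalar_simps, OF UNIV_I UNIV_I]
  smult_r_distr[unfolded scalar_simps, OF UNIV_I]
  smult_assoc1[unfolded scalar_simps, OF UNIV_I UNIV_I]
  smult_one[unfolded scalar_simps] smult_l_null[unfolded scalar_simps]
  smult_r_null[unfolded scalar_simps, OF UNIV_I]
  smult_mult_left[unfolded scalar_simps, OF UNIV_I]
  smult_mult_right[unfolded scalar_simps, OF UNIV_I]
  act_smult[unfolded scalar_simps, OF _ UNIV_I]

text \<open>
  \<open>rel n d p\<close>: the symbol of \<open>d\<close> in degree \<open>n\<close> corresponds to the class of the form \<open>p\<close> under \<open>gr D \<cong> E3\<close>.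
  Working with this relation avoids showing that \<open>gr D\<close> is a ring.
\<close>

definition rel :: "nat \<Rightarrow> 'd \<Rightarrow> 'k free_alg \<Rightarrow> bool"
  where "rel n d p \<longleftrightarrow> d \<in> piece D n \<and> p \<in> free_homog n \<and> \<psi> (symbol D n d) = free_coset I0 p"

lemma E3_simps:
  "free_coset I0 p \<otimes>\<^bsub>E3\<^esub> free_coset I0 q = free_coset I0 (p * q)"
  "free_coset I0 p \<oplus>\<^bsub>E3\<^esub> free_coset I0 q = free_coset I0 (p + q)"
  "\<one>\<^bsub>E3\<^esub> = free_coset I0 1"
  "k \<odot>\<^bsub>E3\<^esub> free_coset I0 p = free_coset I0 (free_const k * p)"
  "piece E3 n = free_coset I0 ` free_homog n"
  using quotient_free_simps[OF FK_ideal_ideal[of 0 0]] by (simp_all add: E3_eq)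

lemma E3_act:
  assumes "u permutes {1..3}"
  shows "act E3 u (free_coset I0 p) = free_coset I0 (S3_act u p)"
proof -
  have "act (quotient_alg free_filtered I0) u (free_coset I0 p) = free_coset I0 (S3_act u p)"
    by (rule quotient_free_simps(7)[OF FK_ideal_ideal FK_ideal_S3_act[OF assms]])
  then show ?thesis by (simp add: E3_eq)
qed

lemma relD: "rel n d p \<Longrightarrow> d \<in> piece D n" "rel n d p \<Longrightarrow> p \<in> free_homog n" "rel n d p \<Longrightarrow> d \<in> carrier D"
  by (auto simp: rel_def intro: piece_carrier)

lemma symbol_carrier: "d \<in> piece D n \<Longrightarrow> symbol D n d \<in> carrier (gr D)"
  using symbol_piece[of d n] by (simp add: gr_simps)

lemma hom: "\<psi> \<in> ring_hom (gr D) E3" and inj: "inj_on \<psi> (carrier (gr D))"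
  and iso_piece: "\<psi> ` piece (gr D) n = piece E3 n"
  and iso_smult: "x \<in> carrier (gr D) \<Longrightarrow> \<psi> (k \<odot>\<^bsub>gr D\<^esub> x) = k \<odot>\<^bsub>E3\<^esub> \<psi> x"
  and iso_act: "\<lbrakk>u permutes {1..3}; x \<in> carrier (gr D)\<rbrakk> \<Longrightarrow> \<psi> (act (gr D) u x) = act E3 u (\<psi> x)"
  using iso by (auto simp: module_alg_iso_def ring_iso_def scalar_simps bij_betw_def sym_group_carrier)

lemma piece_add: "\<lbrakk>x \<in> piece D n; y \<in> piece D n\<rbrakk> \<Longrightarrow> x \<oplus>\<^bsub>D\<^esub> y \<in> piece D n"
  using submoduleE(5)[OF piece_submodule] .

lemma piece_smult: "x \<in> piece D n \<Longrightarrow> k \<odot>\<^bsub>D\<^esub> x \<in> piece D n"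
  using submoduleE(4)[OF piece_submodule, of k x n] by (simp add: scalar_simps)

lemma rel_add:
  assumes d: "rel n d p" and e: "rel n e q"
  shows "rel n (d \<oplus>\<^bsub>D\<^esub> e) (p + q)"
proof -
  have "\<psi> (symbol D n (d \<oplus>\<^bsub>D\<^esub> e)) = \<psi> (symbol D n d \<oplus>\<^bsub>gr D\<^esub> symbol D n e)"
    by (simp only: symbol_add[OF relD(3)[OF d] relD(3)[OF e]])
  also have "\<dots> = \<psi> (symbol D n d) \<oplus>\<^bsub>E3\<^esub> \<psi> (symbol D n e)"
    by (rule ring_hom_add[OF hom symbol_carrier[OF relD(1)[OF d]] symbol_carrier[OF relD(1)[OF e]]])
  also have "\<dots> = free_coset I0 (p + q)"
    using d e by (simp only: rel_def E3_simps)
  finally show ?thesis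
    using d e unfolding rel_def by (intro conjI piece_add free_homog_add) blast+
qed

lemma rel_smult:
  assumes d: "rel n d p"
  shows "rel n (k \<odot>\<^bsub>D\<^esub> d) (free_const k * p)"
proof -
  have "\<psi> (symbol D n (k \<odot>\<^bsub>D\<^esub> d)) = \<psi> (k \<odot>\<^bsub>gr D\<^esub> symbol D n d)"
    by (subst symbol_smult) (simp_all add: scalar_simps relD(3)[OF d])
  also have "\<dots> = k \<odot>\<^bsub>E3\<^esub> \<psi> (symbol D n d)"
    by (rule iso_smult[OF symbol_carrier[OF relD(1)[OF d]]])
  also have "\<dots> = free_coset I0 (free_const k * p)"
    using d by (simp only: rel_def E3_simps)
  finally show ?thesis
    using d unfolding rel_def by (intro conjI piece_smult free_homog_const_mult) blast+
qed

lemma rel_act: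
  assumes u: "u permutes {1..3}" and d: "rel n d p"
  shows "rel n (act D u d) (S3_act u p)"
proof -
  have uG: "u \<in> carrier (sym_group 3)" using u by (simp only: sym_group_carrier)
  have "\<psi> (symbol D n (act D u d)) = \<psi> (act (gr D) u (symbol D n d))"
    by (simp only: symbol_act[OF uG relD(3)[OF d]])
  also have "\<dots> = act E3 u (\<psi> (symbol D n d))"
    by (rule iso_act[OF u symbol_carrier[OF relD(1)[OF d]]])
  also have "\<dots> = free_coset I0 (S3_act u p)"
    using d by (simp only: rel_def E3_act[OF u])
  finally show ?thesis
    using d uG unfolding rel_def by (intro conjI piece_act free_homog_S3_act) blast+
qed

lemma rel_mult:
  assumes d: "rel m d p" and e: "rel n e q"
  shows "rel (m + n) (d \<otimes>\<^bsub>D\<^esub> e) (p * q)"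
proof -
  have "\<psi> (symbol D (m + n) (d \<otimes>\<^bsub>D\<^esub> e)) = \<psi> (symbol D m d \<otimes>\<^bsub>gr D\<^esub> symbol D n e)"
    by (simp only: symbol_mult[OF relD(1)[OF d] relD(1)[OF e]])
  also have "\<dots> = \<psi> (symbol D m d) \<otimes>\<^bsub>E3\<^esub> \<psi> (symbol D n e)"
    by (rule ring_hom_mult[OF hom symbol_carrier[OF relD(1)[OF d]] symbol_carrier[OF relD(1)[OF e]]])
  also have "\<dots> = free_coset I0 (p * q)"
    using d e by (simp only: rel_def E3_simps)
  finally show ?thesis
    using d e unfolding rel_def by (intro conjI piece_mult free_homog_mult) blast+
qed

lemma rel_one: "rel 0 \<one>\<^bsub>D\<^esub> 1"
  using ring_hom_one[OF hom] free_homog_const[of 1]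
  by (simp add: rel_def piece_one symbol_one E3_simps)

lemma rel_ex_left: "p \<in> free_homog n \<Longrightarrow> \<exists>d. rel n d p"
  using iso_piece[of n] E3_simps(5)[of n] gr_pieceE[of _ n]
  unfolding rel_def by (metis (no_types, lifting) imageE imageI)

lemma rel_ex_right:
  assumes "d \<in> piece D n" shows "\<exists>p. rel n d p"
proof -
  have "\<psi> (symbol D n d) \<in> free_coset I0 ` free_homog n"
    using iso_piece[of n] symbol_piece[OF assms] unfolding E3_simps(5) by blast
  then show ?thesis using assms by (auto simp: rel_def)
qed

text \<open>Obtained by scaling any partner of the form 0 by the scalar 0; preservation of zero by
  \<psi> would rest on the ring axioms for \<open>gr D\<close>.\<close>

lemma rel_zero: "rel n \<zero>\<^bsub>D\<^esub> 0"
proof -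
  obtain d where d: "rel n d 0" using rel_ex_left[OF free_homog_zero] by blast
  with rel_smult[OF d, of 0] show ?thesis by (simp add: smult_simps relD(3))
qed

text \<open>Injectivity of \<psi>: a symbol vanishes exactly if its class in \<open>E3\<close> does.
  Both conditions on leading forms in \<open>FK_deformation\<close> go back to this
  equivalence.\<close>

lemma rel_lower_iff:
  assumes "rel n d p" shows "d \<in> lower D n \<longleftrightarrow> p \<in> I0"
proof -
  have "symbol D n \<zero>\<^bsub>D\<^esub> = \<zero>\<^bsub>gr D\<^esub>" using lower_zero by (simp add: symbol_zero_iff)
  then have "d \<in> lower D n \<longleftrightarrow> symbol D n d = symbol D n \<zero>\<^bsub>D\<^esub>"
    using symbol_zero_iff[OF relD(3)[OF assms], of n] by simp
  also have "\<dots> \<longleftrightarrow> \<psi> (symbol D n d) = \<psi> (symbol D n \<zero>\<^bsub>D\<^esub>)"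
    using inj_on_eq_iff[OF inj] symbol_carrier relD(1)[OF assms] piece_zero by metis
  also have "\<dots> \<longleftrightarrow> free_coset I0 p = free_coset I0 0"
    using assms rel_zero by (simp add: rel_def)
  also have "\<dots> \<longleftrightarrow> p \<in> I0" by (simp add: free_coset_eq_iff[OF FK_ideal_ideal])
  finally show ?thesis .
qed

abbreviation sgn_K :: "(nat \<Rightarrow> nat) \<Rightarrow> 'k"
  where "sgn_K u \<equiv> of_int (sign u)"

text \<open>
  A lift of \<open>a\<close> to the first step of the filtration can be made equivariant under its stabiliser
  \<open>{id, (23)}\<close> by averaging over this group of order 2. Its translates are the lifts of all generators.
\<close>

lemma equivariant_lift:
  "\<exists>T. (\<forall>x. rel 1 (T x) (free_var x)) \<and>
    (\<forall>u x. u permutes {1..3} \<longrightarrow> act D u (T x) = sgn_K u \<odot>\<^bsub>D\<^esub> T (perm_gen u x))"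
proof -
  let ?t = "Transposition.transpose 2 3 :: nat \<Rightarrow> nat"
  have t: "?t permutes {1..3}" by (rule permutes_swap_id) auto
  then have tG: "?t \<in> carrier (sym_group 3)" by (simp add: sym_group_carrier)
  obtain d where d: "rel 1 d (free_var Gen_a)" using rel_ex_left[OF free_homog_var] by blast
  note dc = relD(3)[OF d]
  define h :: 'k where "h = 1 / 2"
  have h: "h + h = 1" using two by (simp add: h_def flip: mult_2)
  \<comment> \<open>The minus sign projects onto the sign character of the stabiliser, because (23)
    sends a to - a; a plain average would have symbol 0.\<close>
  define e where "e = h \<odot>\<^bsub>D\<^esub> d \<oplus>\<^bsub>D\<^esub> (- h) \<odot>\<^bsub>D\<^esub> act D ?t d"
  have td: "act D ?t d \<in> carrier D" using act_closed[OF tG dc] .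
  have ec: "e \<in> carrier D" using dc td by (simp add: e_def smult_simps)
  have "rel 1 e (free_const h * free_var Gen_a + free_const (- h) * S3_act ?t (free_var Gen_a))"
    unfolding e_def by (intro rel_add rel_smult rel_act d t)
  also have "free_const h * free_var Gen_a + free_const (- h) * S3_act ?t (free_var Gen_a) =
    free_const (h + h) * free_var Gen_a"
    by (simp only: S3_act_23 free_const_uminus free_const_add distrib_right minus_mult_minus)
  finally have e: "rel 1 e (free_var Gen_a)" by (simp add: h)
  have tt: "act D ?t (act D ?t d) = d"
    using act_mult[OF tG tG dc] act_one[OF dc] by (simp add: sym_group_mult sym_group_one)
  have "act D ?t e = (- 1) \<odot>\<^bsub>D\<^esub> e"
    using dc td tG unfolding e_def
    by (simp add: act_add smult_simps tt a_comm flip: smult_simps(4))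
  then have stab: "act D u e = sgn_K u \<odot>\<^bsub>D\<^esub> e" if "u permutes {1..3}" "u 1 = 1" for u
  proof -
    have "u permutes {2, 3}"
    proof (rule permutes_superset[OF that(1)])
      show "\<And>x. x \<in> {1..3} - {2, 3} \<Longrightarrow> u x = x" using that(2) by (auto simp: le_Suc_eq numeral_eq_Suc)
    qed
    then have "u = id \<or> u = ?t" by (simp add: permutes_doubleton_iff)
    moreover have "act D id e = e" using act_one[OF ec] by (simp add: sym_group_one)
    ultimately show ?thesis
      using \<open>act D ?t e = (- 1) \<odot>\<^bsub>D\<^esub> e\<close> ec by (auto simp: sign_id sign_swap_id smult_simps)
  qed
  \<comment> \<open>Coset representatives of the stabiliser of 1: \<open>g x\<close> is an
    involution moving a to \<open>x\<close>, and the identity if \<open>x\<close> is a.\<close>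
  define g where "g x = Transposition.transpose 1 (gen_index x)" for x
  have g: "g x permutes {1..3}" for x
    unfolding g_def using gen_index_range[of x] by (intro permutes_swap_id) auto
  have gG: "g x \<in> carrier (sym_group 3)" for x using g by (simp add: sym_group_carrier)
  have gg: "g x \<circ> g x = id" for x by (simp add: g_def)
  have g1: "perm_gen (g x) Gen_a = x" for x by (rule perm_gen_eqI) (simp add: g_def)
  have perm: "permutation u" if "u permutes {1..3::nat}" for u
    using that permutation_permutes by blast
  have sgn_sq: "sgn_K u * sgn_K u = 1" for u by (simp add: sign_def)
  have sgn_comp: "sgn_K (u \<circ> v) = sgn_K u * sgn_K v" if "u permutes {1..3::nat}" "v permutes {1..3::nat}" for u v
    using that by (simp add: sign_compose perm)
  have act_comp: "act D (u \<circ> v) x = act D u (act D v x)"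
    if "u permutes {1..3}" "v permutes {1..3}" "x \<in> carrier D" for u v x
    using act_mult[of u v x] that by (simp add: sym_group_carrier sym_group_mult)
  have actc: "act D u x \<in> carrier D" if "u permutes {1..3}" "x \<in> carrier D" for u x
    using that act_closed by (simp add: sym_group_carrier)
  \<comment> \<open>The factor compensates the sign with which \<open>g x\<close> sends a to
    \<open>x\<close>.\<close>
  define T where "T x = sgn_K (g x) \<odot>\<^bsub>D\<^esub> act D (g x) e" for x
  have base: "act D u e = sgn_K u \<odot>\<^bsub>D\<^esub> T (perm_gen u Gen_a)" if u: "u permutes {1..3}" for u
  proof -
    let ?g = "g (perm_gen u Gen_a)"
    \<comment> \<open>Composing with \<open>?g\<close> brings \<open>u\<close> into the stabiliser,
      where \<open>stab\<close> applies; applying the involution \<open>?g\<close> once more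
      recovers the action of \<open>u\<close>.\<close>
    have "(?g \<circ> u) 1 = 1"
      using gen_index_perm_gen[OF u, of Gen_a] by (simp add: g_def)
    then have "act D (?g \<circ> u) e = sgn_K (?g \<circ> u) \<odot>\<^bsub>D\<^esub> e"
      by (intro stab permutes_compose u g)
    then have "act D ?g (act D ?g (act D u e)) = act D ?g (sgn_K (?g \<circ> u) \<odot>\<^bsub>D\<^esub> e)"
      by (simp only: act_comp[OF g u ec])
    moreover have "act D ?g (act D ?g (act D u e)) = act D u e"
      by (simp only: act_comp[OF g g actc[OF u ec], symmetric] gg act_one[OF actc[OF u ec], unfolded sym_group_one])
    moreover have "act D ?g (sgn_K (?g \<circ> u) \<odot>\<^bsub>D\<^esub> e) = sgn_K (?g \<circ> u) \<odot>\<^bsub>D\<^esub> act D ?g e"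
      using act_smult[OF gG _ ec] by (simp add: scalar_simps)
    moreover have "sgn_K (?g \<circ> u) = sgn_K u * sgn_K ?g"
      by (simp only: sgn_comp[OF g u] mult.commute)
    ultimately show ?thesis
      using smult_simps(4)[OF actc[OF g ec]] by (simp only: T_def)
  qed
  have T_act: "act D u (T x) = sgn_K u \<odot>\<^bsub>D\<^esub> T (perm_gen u x)" if u: "u permutes {1..3}" for u x
  proof -
    have "perm_gen (u \<circ> g x) Gen_a = perm_gen u x"
      by (rule perm_gen_eqI) (metis u g g1 gen_index_perm_gen o_apply)
    moreover have "act D u (T x) = sgn_K (g x) \<odot>\<^bsub>D\<^esub> act D (u \<circ> g x) e"
      unfolding T_def act_comp[OF u g ec]
      using u actc[OF g ec] by (intro smult_simps(10)) (simp_all add: sym_group_carrier)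
    moreover have "T y \<in> carrier D" for y unfolding T_def by (intro smult_simps actc g ec)
    moreover have "sgn_K (g x) * sgn_K (u \<circ> g x) = sgn_K u"
      using sgn_sq[of "g x"] by (simp only: sgn_comp[OF u g] mult.left_commute mult_1_right)
    ultimately show ?thesis
      using base[OF permutes_compose[OF g u], of x] by (simp only: smult_simps(4)[symmetric])
  qed
  have T_rel: "rel 1 (T x) (free_var x)" for x
  proof -
    have "rel 1 (T x) (free_const (sgn_K (g x)) * S3_act (g x) (free_var Gen_a))"
      unfolding T_def by (intro rel_smult rel_act g e)
    moreover have "sign (g x) = 1 \<or> sign (g x) = - 1" by (simp add: sign_def)
    ultimately show ?thesis by (elim disjE) (simp_all add: S3_act_def g1 free_const_uminus)
  qed
  show ?thesis
  proof (intro exI[of _ T] conjI allI impI)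
    show "rel 1 (T x) (free_var x)" for x by (rule T_rel)
    show "act D u (T x) = sgn_K u \<odot>\<^bsub>D\<^esub> T (perm_gen u x)" if "u permutes {1..3}" for u x
      using that by (rule T_act)
  qed
qed

end


section \<open>Evaluation of the free algebra at the lifted generators\<close>

locale FK_lift = FK_graded D \<psi> for D :: "(nat \<Rightarrow> nat, 'k::field, 'd) module_alg" and \<psi> +
  fixes T :: "gen \<Rightarrow> 'd"
  assumes T_rel: "rel 1 (T x) (free_var x)"
    and T_act: "u permutes {1..3} \<Longrightarrow> act D u (T x) = of_int (sign u) \<odot>\<^bsub>D\<^esub> T (perm_gen u x)"
begin

definition mon :: "gen list \<Rightarrow> 'd"
  where "mon xs = foldr (\<lambda>x y. T x \<otimes>\<^bsub>D\<^esub> y) xs \<one>\<^bsub>D\<^esub>"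

text \<open>The homomorphism from the universal property of the free algebra with generators going
  to \<open>T\<close>; \<open>free_hom\<close> has the free algebra itself as target, whereas D is a
  record.\<close>

definition \<phi> :: "'k free_alg \<Rightarrow> 'd"
  where "\<phi> p = (\<Oplus>\<^bsub>D\<^esub>w\<in>Poly_Mapping.keys p. Poly_Mapping.lookup p w \<odot>\<^bsub>D\<^esub> mon (letters w))"

lemma T_closed: "T x \<in> carrier D"
  by (rule relD(3)[OF T_rel])

lemma mon_closed: "mon xs \<in> carrier D"
  by (induction xs) (simp_all add: mon_def T_closed)

lemma mon_append: "mon (xs @ ys) = mon xs \<otimes>\<^bsub>D\<^esub> mon ys"
proof (induction xs)
  case Nil
  then show ?case using mon_closed[of ys] by (simp add: mon_def)
next
  case (Cons x xs)
  then show ?case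
    using m_assoc[OF T_closed[of x] mon_closed[of xs] mon_closed[of ys]] by (simp add: mon_def)
qed

lemma term_closed: "k \<odot>\<^bsub>D\<^esub> mon xs \<in> carrier D"
  by (rule smult_simps(1)[OF mon_closed])

lemma \<phi>_alt:
  assumes "finite W" "Poly_Mapping.keys p \<subseteq> W"
  shows "\<phi> p = (\<Oplus>\<^bsub>D\<^esub>w\<in>W. Poly_Mapping.lookup p w \<odot>\<^bsub>D\<^esub> mon (letters w))"
  unfolding \<phi>_def
proof (rule add.finprod_mono_neutral_cong_left[OF assms])
  show "Poly_Mapping.lookup p w \<odot>\<^bsub>D\<^esub> mon (letters w) = \<zero>\<^bsub>D\<^esub>" if "w \<in> W - Poly_Mapping.keys p" for w
    using that smult_simps(6)[OF mon_closed] by (simp add: in_keys_iff)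
qed (simp_all add: term_closed)

lemma \<phi>_closed: "\<phi> p \<in> carrier D"
  unfolding \<phi>_def by (intro finsum_closed) (simp add: term_closed)

lemma \<phi>_add: "\<phi> (p + q) = \<phi> p \<oplus>\<^bsub>D\<^esub> \<phi> q"
proof -
  let ?W = "Poly_Mapping.keys p \<union> Poly_Mapping.keys q"
  have fin: "finite ?W" by simp
  have "\<phi> (p + q) = (\<Oplus>\<^bsub>D\<^esub>w\<in>?W. Poly_Mapping.lookup (p + q) w \<odot>\<^bsub>D\<^esub> mon (letters w))"
    by (rule \<phi>_alt[OF fin Poly_Mapping.keys_add])
  also have "\<dots> = (\<Oplus>\<^bsub>D\<^esub>w\<in>?W. Poly_Mapping.lookup p w \<odot>\<^bsub>D\<^esub> mon (letters w)
    \<oplus>\<^bsub>D\<^esub> Poly_Mapping.lookup q w \<odot>\<^bsub>D\<^esub> mon (letters w))"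
    by (simp only: lookup_add smult_simps(2)[OF mon_closed])
  also have "\<dots> = \<phi> p \<oplus>\<^bsub>D\<^esub> \<phi> q"
    unfolding \<phi>_alt[OF fin Un_upper1] \<phi>_alt[OF fin Un_upper2]
    by (rule add.finprod_multf) (simp_all add: term_closed)
  finally show ?thesis .
qed

lemma \<phi>_single: "\<phi> (Poly_Mapping.single w k) = k \<odot>\<^bsub>D\<^esub> mon (letters w)"
proof -
  have "\<phi> (Poly_Mapping.single w k) =
    (\<Oplus>\<^bsub>D\<^esub>v\<in>{w}. Poly_Mapping.lookup (Poly_Mapping.single w k) v \<odot>\<^bsub>D\<^esub> mon (letters v))"
    by (rule \<phi>_alt) auto
  also have "\<dots> = k \<odot>\<^bsub>D\<^esub> mon (letters w)"
    using term_closed[of k "letters w"] by simp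
  finally show ?thesis .
qed

lemma \<phi>_zero: "\<phi> 0 = \<zero>\<^bsub>D\<^esub>"
  by (simp add: \<phi>_def)

lemma \<phi>_const: "\<phi> (free_const k) = k \<odot>\<^bsub>D\<^esub> \<one>\<^bsub>D\<^esub>"
  by (simp add: free_const_def \<phi>_single zero_word_def mon_def)

lemma \<phi>_one: "\<phi> 1 = \<one>\<^bsub>D\<^esub>"
  using \<phi>_const[of 1] smult_simps(5)[OF one_closed] by simp

lemma \<phi>_var: "\<phi> (free_var x) = T x"
  using smult_simps(5)[OF T_closed[of x]] T_closed[of x] by (simp add: free_var_def \<phi>_single mon_def)

lemma \<phi>_mult: "\<phi> (p * q) = \<phi> p \<otimes>\<^bsub>D\<^esub> \<phi> q"
proof (induction p rule: free_induct)
  case v: (single v k)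
  show ?case
  proof (induction q rule: free_induct)
    case w: (single w l)
    let ?v = "mon (letters v)" and ?w = "mon (letters w)"
    have "\<phi> (Poly_Mapping.single v k * Poly_Mapping.single w l) = (k * l) \<odot>\<^bsub>D\<^esub> (?v \<otimes>\<^bsub>D\<^esub> ?w)"
      by (simp add: mult_single \<phi>_single plus_word_def mon_append)
    also have "\<dots> = k \<odot>\<^bsub>D\<^esub> (?v \<otimes>\<^bsub>D\<^esub> (l \<odot>\<^bsub>D\<^esub> ?w))"
      by (simp only: smult_simps(4)[OF m_closed[OF mon_closed mon_closed]] smult_simps(9)[OF mon_closed mon_closed])
    also have "\<dots> = (k \<odot>\<^bsub>D\<^esub> ?v) \<otimes>\<^bsub>D\<^esub> (l \<odot>\<^bsub>D\<^esub> ?w)"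
      by (simp only: smult_simps(8)[OF mon_closed term_closed])
    finally show ?case by (simp only: \<phi>_single)
  next
    case (sum p q)
    then show ?case by (simp only: distrib_left \<phi>_add r_distr[OF \<phi>_closed \<phi>_closed \<phi>_closed])
  qed
next
  case (sum p p')
  then show ?case by (simp only: distrib_right \<phi>_add l_distr[OF \<phi>_closed \<phi>_closed \<phi>_closed])
qed

lemma \<phi>_smult: "\<phi> (free_const k * p) = k \<odot>\<^bsub>D\<^esub> \<phi> p"
  using smult_simps(8)[OF one_closed \<phi>_closed[of p]] \<phi>_closed[of p] by (simp add: \<phi>_mult \<phi>_const)

lemma \<phi>_uminus: "\<phi> (- p) = \<ominus>\<^bsub>D\<^esub> \<phi> p"
  using minus_equality[of "\<phi> (- p)" "\<phi> p"] \<phi>_add[of "- p" p] \<phi>_closed by (simp add: \<phi>_zero)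

lemma \<phi>_diff: "\<phi> (p - q) = \<phi> p \<ominus>\<^bsub>D\<^esub> \<phi> q"
  using \<phi>_add[of p "- q"] by (simp add: \<phi>_uminus a_minus_def)

text \<open>Both sides respect constants, sums and products, so the claim reduces to the generators,
  where it is \<open>T_act\<close>.\<close>

lemma \<phi>_act:
  assumes u: "u permutes {1..3}"
  shows "\<phi> (S3_act u p) = act D u (\<phi> p)"
proof (induction p rule: free_alg_induct)
  have uG: "u \<in> carrier (sym_group 3)" using u by (simp only: sym_group_carrier)
  {
    case (const k)
    have "act D u (k \<odot>\<^bsub>D\<^esub> \<one>\<^bsub>D\<^esub>) = k \<odot>\<^bsub>D\<^esub> \<one>\<^bsub>D\<^esub>"
      using smult_simps(10)[OF uG one_closed] act_unit[OF uG] by simp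
    then show ?case by (simp only: S3_act_hom \<phi>_const)
  next
    case (var x)
    have "S3_act u (free_var x) = free_const (of_int (sign u)) * (free_var (perm_gen u x) :: 'k free_alg)"
      by (simp add: S3_act_def sign_def free_const_uminus)
    then show ?case by (simp only: \<phi>_smult \<phi>_var T_act[OF u])
  next
    case (add p q)
    then show ?case by (simp only: S3_act_hom \<phi>_add act_add[OF uG \<phi>_closed \<phi>_closed])
  next
    case (mult p q)
    then show ?case by (simp only: S3_act_hom \<phi>_mult act_times[OF uG \<phi>_closed \<phi>_closed])
  }
qed

text \<open>On words this is multiplicativity of \<open>rel\<close>. The induction concerns the
  degree \<open>n\<close> part of an arbitrary element, since the summands of a form need not be
  forms.\<close>

lemma \<phi>_rel: "p \<in> free_homog n \<Longrightarrow> rel n (\<phi> p) p"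
proof -
  have word: "rel (length xs) (mon xs) (prod_list (map free_var xs))" for xs
  proof (induction xs)
    case Nil
    show ?case using rel_one by (simp add: mon_def)
  next
    case (Cons x xs)
    from rel_mult[OF T_rel this] show ?case by (simp add: mon_def)
  qed
  have "rel n (\<phi> (free_part n q)) (free_part n q)" for q
  proof (induction q rule: free_induct)
    case (single w k)
    show ?case
    proof (cases "length (letters w) = n")
      case True
      with rel_smult[OF word[of "letters w"], of k] show ?thesis
        by (simp only: free_part_single simp_thms if_True \<phi>_single single_eq[symmetric])
    next
      case False
      then show ?thesis by (simp only: free_part_single if_False \<phi>_zero rel_zero)
    qed
  next
    case (sum p q)
    then show ?case by (simp only: free_part_add \<phi>_add rel_add)
  qed
  then show "rel n (\<phi> p) p" if "p \<in> free_homog n"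
    using free_part_of_homog[OF that] by metis
qed

lemma \<phi>_lower: "p \<in> free_below n \<Longrightarrow> \<phi> p \<in> lower D n"
proof (induction n arbitrary: p)
  case 0
  then show ?case by (simp add: free_below_0 \<phi>_zero lower_def)
next
  case (Suc n)
  then have p: "p \<in> free_upto n" by (simp only: free_below_Suc)
  have "\<phi> (free_part n p) \<in> piece D n"
    by (rule relD(1)[OF \<phi>_rel[OF free_part_homog]])
  moreover have "\<phi> (p - free_part n p) \<in> piece D n"
    using Suc.IH[OF free_part_below[OF p]] lower_piece by blast
  ultimately have "\<phi> (free_part n p + (p - free_part n p)) \<in> piece D n"
    unfolding \<phi>_add by (rule piece_add)
  then show ?case by (simp add: lower_def)
qed

text \<open>Successive approximation: subtracting the value of a form with the same symbol drops the
  degree, and the process ends at \<open>lower D 0\<close>, which is zero. In particular D is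
  generated by the lifts.\<close>

lemma \<phi>_lower_surj: "d \<in> lower D n \<Longrightarrow> \<exists>p\<in>free_below n. \<phi> p = d"
proof (induction n arbitrary: d)
  case 0
  then show ?case by (simp add: free_below_0 \<phi>_zero lower_def)
next
  case (Suc n)
  then have d: "d \<in> piece D n" by (simp add: lower_def)
  then obtain p where p: "rel n d p" using rel_ex_right by blast
  note ph = relD(2)[OF p]
  have "rel n (d \<oplus>\<^bsub>D\<^esub> \<phi> (- p)) (p + - p)"
    by (rule rel_add[OF p \<phi>_rel[OF free_homog_uminus[OF ph]]])
  then have "d \<oplus>\<^bsub>D\<^esub> \<phi> (- p) \<in> lower D n"
    using rel_lower_iff free_ideal_zero[OF FK_ideal_ideal] by simp
  from Suc.IH[OF this] obtain q where q: "q \<in> free_below n" "\<phi> q = d \<oplus>\<^bsub>D\<^esub> \<phi> (- p)" by blast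
  have "\<phi> (q + p) = d"
    unfolding \<phi>_add q(2) \<phi>_uminus using relD(3)[OF p] \<phi>_closed[of p] by (simp add: a_assoc l_neg)
  moreover have "q + p \<in> free_below (Suc n)"
    unfolding free_below_Suc
  proof (rule free_upto_add)
    show "q \<in> free_upto n" using q(1) by (auto simp: free_below_def free_upto_def less_imp_le)
    show "p \<in> free_upto n" using ph free_homog_upto by blast
  qed
  ultimately show ?case by blast
qed

lemma \<phi>_image_upto: "\<phi> ` free_upto n = piece D n"
  using \<phi>_lower[of _ "Suc n"] \<phi>_lower_surj[of _ "Suc n"]
  by (auto simp: free_below_Suc lower_def image_iff)

lemma \<phi>_surj: "range \<phi> = carrier D"
proof -
  have "range \<phi> = (\<Union>n. \<phi> ` free_upto n)" using free_upto_exhaustive by blast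
  then show ?thesis by (simp only: \<phi>_image_upto piece_exhaustive)
qed

section \<open>The kernel of the evaluation and the isomorphism with \<open>D3\<close>\<close>

definition ker :: "'k free_alg set" where "ker = {p. \<phi> p = \<zero>\<^bsub>D\<^esub>}"

lemma \<phi>_eq_iff: "\<phi> p = \<phi> q \<longleftrightarrow> p - q \<in> ker"
  unfolding ker_def mem_Collect_eq \<phi>_diff using \<phi>_closed r_right_minus_eq by metis

text \<open>For \<open>leading\<close>, \<phi> of the top part of a kernel element is minus \<phi>
  of the rest, so it lies in \<open>lower D n\<close> and \<open>rel_lower_iff\<close> applies. For
  \<open>lift\<close>, that equivalence puts \<open>\<phi> p\<close> into \<open>lower D n\<close>,
  where it is also attained on \<open>free_below n\<close>.\<close>

lemma FK_deformation_ker: "FK_deformation ker"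
proof
  show "(2 :: 'k) \<noteq> 0" by (rule two)
  show "free_ideal ker"
    by (rule free_idealI) (simp_all add: ker_def \<phi>_zero \<phi>_add \<phi>_mult \<phi>_closed)
  show "S3_act u p \<in> ker" if u: "u permutes {1..3}" and p: "p \<in> ker" for u p
  proof -
    have "u \<in> carrier (sym_group 3)" using u by (simp only: sym_group_carrier)
    from act_zero[OF this] show ?thesis using p by (simp add: ker_def \<phi>_act[OF u])
  qed
  show "free_part n p \<in> I0" if p: "p \<in> ker" "p \<in> free_upto n" for p n
  proof -
    have "\<phi> (p - (p - free_part n p)) = \<ominus>\<^bsub>D\<^esub> \<phi> (p - free_part n p)"
      unfolding \<phi>_diff[of p "p - free_part n p"] using p(1) \<phi>_closed by (simp add: ker_def a_minus_def)
    also have "\<dots> = \<phi> (- (p - free_part n p))" by (simp only: \<phi>_uminus)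
    also have "\<dots> \<in> lower D n"
      by (intro \<phi>_lower free_below_uminus free_part_below p(2))
    finally have "\<phi> (free_part n p) \<in> lower D n" by simp
    then show ?thesis using rel_lower_iff[OF \<phi>_rel[OF free_part_homog]] by blast
  qed
  show "\<exists>q\<in>free_below n. p - q \<in> ker" if p: "p \<in> I0" "p \<in> free_homog n" for p n
  proof -
    have "\<phi> p \<in> lower D n" using rel_lower_iff[OF \<phi>_rel[OF p(2)]] p(1) by blast
    from \<phi>_lower_surj[OF this] show ?thesis unfolding \<phi>_eq_iff[symmetric] by metis
  qed
qed

lemma iso_D3: "\<exists>\<gamma>1 \<gamma>2. module_alg_iso (sym_group 3) (ring_of_type_algebra :: 'k ring) D (D3 \<gamma>1 \<gamma>2) \<noteq> {}"
proof -
  obtain \<gamma>1 \<gamma>2 where ker: "ker = FK_ideal \<gamma>1 \<gamma>2"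
    using FK_deformation.ideal_eq[OF FK_deformation_ker] by blast
  have J: "free_ideal ker" unfolding ker by (rule FK_ideal_ideal)
  note Q = quotient_free_simps[OF J, folded D3_eq[of \<gamma>1 \<gamma>2, folded ker]]
  \<comment> \<open>Cosets of the kernel are the fibres of \<phi>, so the inverse of the induced
    isomorphism is written down without choosing preimages.\<close>
  define \<Phi> where "\<Phi> d = {p. \<phi> p = d}" for d
  have \<Phi>: "\<Phi> (\<phi> p) = free_coset ker p" for p
    by (simp only: \<Phi>_def \<phi>_eq_iff free_coset_def)
  have ex: "\<exists>p. d = \<phi> p" if "d \<in> carrier D" for d
    using that unfolding \<phi>_surj[symmetric] by blast
  let ?B = "D3 \<gamma>1 \<gamma>2"
  have "\<Phi> \<in> ring_hom D ?B"
  proof (rule ring_hom_memI)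
    fix x y assume "x \<in> carrier D" "y \<in> carrier D"
    then obtain p q where xy: "x = \<phi> p" "y = \<phi> q" using ex by blast
    show "\<Phi> x \<in> carrier ?B" unfolding xy \<Phi> Q(1) by blast
    show "\<Phi> (x \<otimes>\<^bsub>D\<^esub> y) = \<Phi> x \<otimes>\<^bsub>?B\<^esub> \<Phi> y"
      unfolding xy \<phi>_mult[symmetric] \<Phi> Q(2) ..
    show "\<Phi> (x \<oplus>\<^bsub>D\<^esub> y) = \<Phi> x \<oplus>\<^bsub>?B\<^esub> \<Phi> y"
      unfolding xy \<phi>_add[symmetric] \<Phi> Q(3) ..
  next
    show "\<Phi> \<one>\<^bsub>D\<^esub> = \<one>\<^bsub>?B\<^esub>" unfolding \<phi>_one[symmetric] \<Phi> Q(4) ..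
  qed
  moreover have "bij_betw \<Phi> (carrier D) (carrier ?B)"
  proof (rule bij_betw_imageI)
    show "inj_on \<Phi> (carrier D)"
    proof (rule inj_onI)
      fix x y assume "x \<in> carrier D" "y \<in> carrier D" "\<Phi> x = \<Phi> y"
      then show "x = y" using ex unfolding \<Phi>_def by blast
    qed
    show "\<Phi> ` carrier D = carrier ?B"
      unfolding \<phi>_surj[symmetric] Q(1) image_image \<Phi> ..
  qed
  moreover have "\<Phi> (k \<odot>\<^bsub>D\<^esub> x) = k \<odot>\<^bsub>?B\<^esub> \<Phi> x" if "x \<in> carrier D" for k x
  proof -
    from ex[OF that] obtain p where x: "x = \<phi> p" ..
    show ?thesis unfolding x \<phi>_smult[symmetric] \<Phi> Q(6) ..
  qed
  moreover have "\<Phi> (act D u x) = act ?B u (\<Phi> x)" if u: "u \<in> carrier (sym_group 3)" and "x \<in> carrier D" for u x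
  proof -
    from ex[OF that(2)] obtain p where x: "x = \<phi> p" ..
    have u: "u permutes {1..3}" using u by (simp only: sym_group_carrier)
    have "S3_act u q \<in> ker" if "q \<in> ker" for q
      using that unfolding ker by (rule FK_ideal_S3_act[OF u])
    from Q(7)[OF this] show ?thesis unfolding x \<phi>_act[OF u, symmetric] \<Phi> by (rule sym)
  qed
  moreover have "\<Phi> ` piece D n = piece ?B n" for n
    unfolding \<phi>_image_upto[symmetric] Q(8) image_image \<Phi> ..
  ultimately have "\<Phi> \<in> module_alg_iso (sym_group 3) (ring_of_type_algebra :: 'k ring) D ?B"
    unfolding module_alg_iso_def ring_iso_def mem_Collect_eq by blast
  then show ?thesis by blast
qed

end

theorem theorem2p15:
  fixes D :: "(nat \<Rightarrow> nat, 'k::alg_closed_field, 'd) module_alg"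
  assumes "CHAR('k) \<noteq> 2"
    and "PBW_deformation (sym_group 3) (ring_of_type_algebra :: 'k ring)
           (E3 :: (nat \<Rightarrow> nat, 'k, 'k free_alg set) module_alg) D"
  shows "\<exists>\<gamma>1 \<gamma>2 :: 'k.
    module_alg_iso (sym_group 3) (ring_of_type_algebra :: 'k ring) D (D3 \<gamma>1 \<gamma>2) \<noteq> {}"
proof -
  have two: "(2 :: 'k) \<noteq> 0"
  proof
    assume "(2 :: 'k) = 0"
    then have "CHAR('k) dvd 2" by (metis of_nat_eq_0_iff_char_dvd of_nat_numeral)
    \<comment> \<open>The value 1 is impossible in a field, where 1 and 0 differ.\<close>
    then have "CHAR('k) = 1 \<or> CHAR('k) = 2" using two_is_prime_nat unfolding prime_nat_iff by blast
    with assms(1) show False by simp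
  qed
  from assms(2) obtain \<psi> where D: "filtered_module_algebra (sym_group 3) (ring_of_type_algebra :: 'k ring) D"
    and \<psi>: "\<psi> \<in> module_alg_iso (sym_group 3) (ring_of_type_algebra :: 'k ring) (gr D) E3"
    unfolding PBW_deformation_def by blast
  interpret FK_graded D \<psi>
    by (intro FK_graded.intro filtered_alg.intro D FK_graded_axioms.intro \<psi> two)
  obtain T where T: "\<And>x. rel 1 (T x) (free_var x)"
    "\<And>u x. u permutes {1..3} \<Longrightarrow> act D u (T x) = of_int (sign u) \<odot>\<^bsub>D\<^esub> T (perm_gen u x)"
    using equivariant_lift by blast
  interpret FK_lift D \<psi> T
    by unfold_locales (fact T)+
  show ?thesis by (rule iso_D3)
qed

end
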